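(* Let $f:\mathbb{R}^n\to\mathbb{R}$ be twice continuously differentiable, convex, radially unbounded, and with a unique minimizer $x^*\in\mathbb{R}^n$, let $c>0$, and let $\mathcal{H}=(F,C,G,D)$ be one of the following hybrid systems defined in the context: either HAND-1, with $0<T_{\min}<T_{\text{med}}\leq T_{\max}<\infty$; or HAND-2, with $0<T_{\min}<T_{\max}<\infty$, in which case it is further assumed that $f$ is $\mu$-strongly convex ($\mu>0$) with globally Lipschitz gradient and that $T_{\max}^2-T_{\min}^2>\frac{1}{\mu c}$. Let $\mathcal{A}:=\{x^*\}\times\{x^*\}\times[T_{\min},T_{\max}]$, and let $\mathcal{H}_h=(F_h,C_h,G_h,D_h)$, $h>0$, be a regular discretization of $\mathcal{H}$ (see context). Then for each $r>\varepsilon>0$ there exists $h^*>0$ such that for all $h\in(0,h^* )$ there exists $T>0$ such that every solution $z_h$ of $\mathcal{H}_h$ with $|z_h(0,0)|_{\mathcal{A}}\leq r$ satisfies $|z_h(k,j)|_{\mathcal{A}}\leq\varepsilon$ for all $(k,j)\in\text{dom}(z_h)$ such that $kh+j\geq T$.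
   Context: Notation: $|z|_{\mathcal{A}}:=\min_{y\in\mathcal{A}}|z-y|$ with $|\cdot|$ Euclidean; $\mathbb{B}$ is the closed unit ball; $\overline{\text{con}}$ denotes closed convex hull; $\mathcal{K}_\infty$ is the class of continuous, strictly increasing functions that are zero at zero and tend to $\infty$ at $\infty$. A function $f$ is radially unbounded if $f(x)\to\infty$ as $|x|\to\infty$. HAND-1 and HAND-2: hybrid systems with state $z=(x_1,x_2,\tau)\in\mathbb{R}^n\times\mathbb{R}^n\times\mathbb{R}$ and dynamics $\dot z=F(z)$ for $z\in C$, $z^+=G(z)$ for $z\in D$. Both have flow map $$F(z)=\left(\tfrac{2}{\tau}(x_2-x_1),\ -2c\tau\nabla f(x_1),\ 1\right)$$ and flow set $C=\{z\in\mathbb{R}^{2n+1}:\tau\in[T_{\min},T_{\max}]\}$. For HAND-1, $G(z)=(x_1,x_2,T_{\min})$ and $D=\{z\in\mathbb{R}^{2n+1}:\tau\in[T_{\text{med}},T_{\max}]\}$. For HAND-2, $G(z)=(x_1,x_1,T_{\min})$ and $D=\{z\in\mathbb{R}^{2n+1}:\tau=T_{\max}\}$. Discretized system: for a step size $h>0$, $\mathcal{H}_h$ is the system $$z^+=F_h(z),\ z\in C_h,\qquad\text{and}\qquad z^+=G_h(z),\ z\in D_h.$$ Its solutions $z_h$ are defined on discrete time domains $\text{dom}(z_h)\subset\mathbb{Z}_{\geq0}\times\mathbb{Z}_{\geq0}$, i.e. sets which, for each $(K,J)$ in them, intersected with $\{0,\dots,K\}\times\{0,\dots,J\}$ have the form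 $\bigcup_{j=0}^{J}\{K_j,K_j+1,\dots,K_{j+1}\}\times\{j\}$ for some $0=K_0\leq K_1\leq\dots\leq K_{J+1}$. A solution satisfies $z_h(0,0)\in C_h\cup D_h$; if $(k,j),(k+1,j)\in\text{dom}(z_h)$ then $z_h(k,j)\in C_h$ and $z_h(k+1,j)=F_h(z_h(k,j))$; if $(k,j),(k,j+1)\in\text{dom}(z_h)$ then $z_h(k,j)\in D_h$ and $z_h(k,j+1)=G_h(z_h(k,j))$ (equality is replaced by membership if the maps are set-valued). Regular discretization: $\mathcal{H}_h$ is regular if (1) for each compact set $K\subset\mathbb{R}^{2n+1}$ there exist $\rho\in\mathcal{K}_\infty$ and $h^*>0$ such that for each $h\in(0,h^*]$ and each $z\in C_h\cap K$, $$F_h(z)\subset z+h\,\overline{\text{con}}\,F(z+\rho(h)\mathbb{B})+h\rho(h)\mathbb{B};$$ (2) for any decreasing sequence $h_i\to0$, the graphical limit $G_0$ of $G_{h_i}$ satisfies $G_0=G$; (3) for any positive, monotone decreasing sequence $h_i\to0$, $\limsup_{i\to\infty}C_{h_i}\subset C$ and $\limsup_{i\to\infty}D_{h_i}\subset D$ (outer limits of sequences of sets).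
   Formalization: Adds the assumption that for each compact K there is h*>0 such that the values G_h(z), z in D_h∩K, 0<h≤h*, form a bounded set; without it graphical convergence of G_h lets a jump from A escape to distance 1/h, and the claim fails. *)

theory Defs
  imports "HOL-Analysis.Analysis"
begin

section \<open>Classes of functions\<close>

definition grad :: "('a::real_inner \<Rightarrow> real) \<Rightarrow> 'a \<Rightarrow> 'a" where
  "grad f x = (THE g. GDERIV f x :> g)"

definition twice_continuously_differentiable :: "('a::euclidean_space \<Rightarrow> real) \<Rightarrow> bool" where
  "twice_continuously_differentiable f \<longleftrightarrow>
     (\<forall>x. f differentiable (at x)) \<and>
     (\<exists>H :: 'a \<Rightarrow> 'a \<Rightarrow>\<^sub>L 'a.
        (\<forall>x. (grad f has_derivative blinfun_apply (H x)) (at x)) \<and> continuous_on UNIV H)"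

definition radially_unbounded :: "('a::real_normed_vector \<Rightarrow> real) \<Rightarrow> bool" where
  "radially_unbounded f \<longleftrightarrow> filterlim f at_top at_infinity"

definition unique_minimizer :: "('a \<Rightarrow> real) \<Rightarrow> 'a \<Rightarrow> bool" where
  "unique_minimizer f xs \<longleftrightarrow> (\<forall>x. is_arg_min f (\<lambda>_. True) x \<longleftrightarrow> x = xs)"

definition strongly_convex :: "real \<Rightarrow> ('a::real_inner \<Rightarrow> real) \<Rightarrow> bool" where
  "strongly_convex \<mu> f \<longleftrightarrow>
     (\<forall>x y. f y \<ge> f x + grad f x \<bullet> (y - x) + \<mu> / 2 * (norm (y - x))\<^sup>2)"

definition class_K_infinity :: "(real \<Rightarrow> real) \<Rightarrow> bool" where
  "class_K_infinity \<rho> \<longleftrightarrow>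
     continuous_on {0..} \<rho> \<and> strict_mono_on {0..} \<rho> \<and> \<rho> 0 = 0 \<and> filterlim \<rho> at_top at_top"


section \<open>Hybrid systems\<close>

text \<open>Flow and jump maps are set-valued; a single-valued map takes singleton values.\<close>

record 'a hybrid_system =
  flow_map :: "'a \<Rightarrow> 'a set"
  flow_set :: "'a set"
  jump_map :: "'a \<Rightarrow> 'a set"
  jump_set :: "'a set"

text \<open>The norm that the library puts on the product type of the states
  \<open>(x\<^sub>1, x\<^sub>2, \<tau>)\<close> is the Euclidean norm. At \<open>\<tau> = 0\<close>, outside the flow set, the
  first component of the flow map is \<open>0\<close> by the convention for division.\<close>

definition HAND_flow ::
  "('a::euclidean_space \<Rightarrow> real) \<Rightarrow> real \<Rightarrow> 'a \<times> 'a \<times> real \<Rightarrow> 'a \<times> 'a \<times> real" where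
  "HAND_flow f c = (\<lambda>(x1, x2, \<tau>).
     ((2 / \<tau>) *\<^sub>R (x2 - x1), (- 2 * c * \<tau>) *\<^sub>R grad f x1, 1))"

definition HAND1 :: "('a::euclidean_space \<Rightarrow> real) \<Rightarrow> real \<Rightarrow> real \<Rightarrow> real \<Rightarrow> real \<Rightarrow>
    ('a \<times> 'a \<times> real) hybrid_system" where
  "HAND1 f c Tmin Tmed Tmax =
    \<lparr> flow_map = (\<lambda>z. {HAND_flow f c z}),
      flow_set = {(x1, x2, \<tau>). \<tau> \<in> {Tmin..Tmax}},
      jump_map = (\<lambda>(x1, x2, \<tau>). {(x1, x2, Tmin)}),
      jump_set = {(x1, x2, \<tau>). \<tau> \<in> {Tmed..Tmax}} \<rparr>"

definition HAND2 :: "('a::euclidean_space \<Rightarrow> real) \<Rightarrow> real \<Rightarrow> real \<Rightarrow> real \<Rightarrow>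
    ('a \<times> 'a \<times> real) hybrid_system" where
  "HAND2 f c Tmin Tmax =
    \<lparr> flow_map = (\<lambda>z. {HAND_flow f c z}),
      flow_set = {(x1, x2, \<tau>). \<tau> \<in> {Tmin..Tmax}},
      jump_map = (\<lambda>(x1, x2, \<tau>). {(x1, x1, Tmin)}),
      jump_set = {(x1, x2, \<tau>). \<tau> = Tmax} \<rparr>"


section \<open>Discretized systems and their solutions\<close>

definition discrete_time_domain :: "(nat \<times> nat) set \<Rightarrow> bool" where
  "discrete_time_domain E \<longleftrightarrow>
     (\<forall>(K, J) \<in> E. \<exists>\<kappa> :: nat \<Rightarrow> nat.
        \<kappa> 0 = 0 \<and> (\<forall>j\<le>J. \<kappa> j \<le> \<kappa> (Suc j)) \<and>
        E \<inter> ({0..K} \<times> {0..J}) = (\<Union>j\<in>{0..J}. {\<kappa> j..\<kappa> (Suc j)} \<times> {j}))"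

text \<open>A solution is given by its domain \<open>E\<close> and a function whose values matter only on \<open>E\<close>.\<close>

definition discrete_solution ::
  "'a hybrid_system \<Rightarrow> (nat \<times> nat) set \<Rightarrow> (nat \<times> nat \<Rightarrow> 'a) \<Rightarrow> bool" where
  "discrete_solution H E z \<longleftrightarrow>
     discrete_time_domain E \<and>
     (0, 0) \<in> E \<and> z (0, 0) \<in> flow_set H \<union> jump_set H \<and>
     (\<forall>k j. (k, j) \<in> E \<and> (Suc k, j) \<in> E \<longrightarrow>
        z (k, j) \<in> flow_set H \<and> z (Suc k, j) \<in> flow_map H (z (k, j))) \<and>
     (\<forall>k j. (k, j) \<in> E \<and> (k, Suc j) \<in> E \<longrightarrow>
        z (k, j) \<in> jump_set H \<and> z (k, Suc j) \<in> jump_map H (z (k, j)))"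


section \<open>Set convergence (Painleve-Kuratowski) and regular discretizations\<close>

definition outer_limit :: "(nat \<Rightarrow> 'a::topological_space set) \<Rightarrow> 'a set" where
  "outer_limit S = {x. \<exists>\<phi> :: nat \<Rightarrow> nat. \<exists>y.
     strict_mono \<phi> \<and> (\<forall>i. y i \<in> S (\<phi> i)) \<and> y \<longlonglongrightarrow> x}"

definition inner_limit :: "(nat \<Rightarrow> 'a::topological_space set) \<Rightarrow> 'a set" where
  "inner_limit S = {x. \<exists>y. (\<forall>\<^sub>F i in sequentially. y i \<in> S i) \<and> y \<longlonglongrightarrow> x}"

definition graph :: "('a \<Rightarrow> 'b set) \<Rightarrow> ('a \<times> 'b) set" where
  "graph M = {(x, y). y \<in> M x}"

definition is_graphical_limit ::
  "(nat \<Rightarrow> 'a::topological_space \<Rightarrow> 'b::topological_space set) \<Rightarrow> ('a \<Rightarrow> 'b set) \<Rightarrow> bool" where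
  "is_graphical_limit M M0 \<longleftrightarrow>
     outer_limit (\<lambda>i. graph (M i)) = graph M0 \<and> inner_limit (\<lambda>i. graph (M i)) = graph M0"

text \<open>Only the values \<open>Hh h\<close> at \<open>h > 0\<close> are meaningful.\<close>

definition regular_discretization ::
  "'a::real_normed_vector hybrid_system \<Rightarrow> (real \<Rightarrow> 'a hybrid_system) \<Rightarrow> bool" where
  "regular_discretization H Hh \<longleftrightarrow>
     (\<forall>K. compact K \<longrightarrow>
        (\<exists>\<rho> hs. class_K_infinity \<rho> \<and> hs > 0 \<and>
          (\<forall>h\<in>{0<..hs}. \<forall>z \<in> flow_set (Hh h) \<inter> K.
             flow_map (Hh h) z \<subseteq>
               {z + h *\<^sub>R v + (h * \<rho> h) *\<^sub>R b | v b.
                  v \<in> closure (convex hull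
                        (\<Union>b'\<in>cball 0 1. flow_map H (z + \<rho> h *\<^sub>R b'))) \<and>
                  b \<in> cball 0 1}))) \<and>
     (\<forall>h :: nat \<Rightarrow> real. decseq h \<and> (\<forall>i. h i > 0) \<and> h \<longlonglongrightarrow> 0 \<longrightarrow>
        is_graphical_limit (\<lambda>i. jump_map (Hh (h i))) (jump_map H)) \<and>
     (\<forall>h :: nat \<Rightarrow> real. decseq h \<and> (\<forall>i. h i > 0) \<and> h \<longlonglongrightarrow> 0 \<longrightarrow>
        outer_limit (\<lambda>i. flow_set (Hh (h i))) \<subseteq> flow_set H \<and>
        outer_limit (\<lambda>i. jump_set (Hh (h i))) \<subseteq> jump_set H)"

text \<open>An assumption on top of graphical convergence, which does not see values that
  escape to infinity: the jump maps may agree with that of \<open>H\<close> except at one point of the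
  jump set, sent to distance \<open>1 / h\<close>, and still their graphs converge to the graph of the
  jump map of \<open>H\<close>. Without this bound solutions could leave every compact set in one jump.\<close>

definition jumps_locally_eventually_bounded ::
  "(real \<Rightarrow> 'a::real_normed_vector hybrid_system) \<Rightarrow> bool" where
  "jumps_locally_eventually_bounded Hh \<longleftrightarrow>
     (\<forall>K. compact K \<longrightarrow>
        (\<exists>hs>0. bounded (\<Union>h\<in>{0<..hs}. \<Union>z \<in> jump_set (Hh h) \<inter> K. jump_map (Hh h) z)))"

end

theory Submission
  imports Defs
begin

text \<open>
  Two functions of the state \<open>(x1, x2, \<tau>)\<close> carry the proof. On the flow
  set, the energy \<open>V = \<bar>x2 - xs\<bar>\<^sup>2 / 2 + c \<tau>\<^sup>2 (f x1 - f xs)\<close> vanishes exactly on the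
  attractor and has compact sublevel sets. Along the flow its rate of change is
  \<open>2 c \<tau> (f x1 - f xs - grad f x1 \<bullet> (x1 - xs))\<close>, which convexity makes nonpositive, and it does
  not grow at jumps: for HAND-1 because \<open>\<tau>\<close> shrinks, for HAND-2 because the condition on
  \<open>Tmax\<^sup>2 - Tmin\<^sup>2\<close> lets the loss of potential energy pay for the change of momentum from
  \<open>x2 - xs\<close> to \<open>x1 - xs\<close>.

  The energy alone is only a weak Lyapunov function: it is stationary whenever \<open>x1 = xs\<close>
  (and, by \<open>convex_tangent_through_minimum\<close>, only then). In place of an invariance principle, which
  would have to be transported to the discretization, the proof uses a second function
  \<open>U = \<tau> \<bar>x2 - xs\<bar>\<^sup>2 / Tmax - (x1 - xs) \<bullet> (x2 - xs)\<close>, in the manner of Matrosov. It may grow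
  elsewhere, but it decreases strictly, along the flow and at the jumps of HAND-1, at the points
  where \<open>x1 = xs\<close> and \<open>x2 \<noteq> xs\<close>. On a compact set that avoids the attractor,
  \<open>W = V + d U\<close> therefore decreases at a uniform rate once \<open>d\<close> is small
  (\<open>strict_decrease_of_weak_and_auxiliary\<close>).

  A uniform rate of decrease of a continuously differentiable function survives discretization.
  For \<open>h \<rightarrow> 0\<close>, steps from a compact set accumulate at steps of the hybrid system
  (\<open>flow_steps_converge\<close>, \<open>jump_steps_converge\<close>), so that for small \<open>h\<close> a flow step lowers \<open>W\<close> by
  at least \<open>h \<kappa>\<close> and a jump by at least \<open>\<kappa>\<close>, except at low energy, where a step stays low. The
  number \<open>k h + j\<close> counts exactly this decrease, so \<open>W\<close> has become small when it exceeds a bound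
  that does not depend on \<open>h\<close> (\<open>practical_stability_of_regular_discretization\<close>).
\<close>


section \<open>Properties that hold for all small step sizes\<close>

text \<open>The limits in the definition of regularity are taken along decreasing sequences of step
  sizes. A property that fails for arbitrarily small step sizes fails along such a sequence, which turns limits along sequences
  into statements about all small step sizes.\<close>

lemma eventually_at_right_0_decseqI:
  assumes "\<And>h :: nat \<Rightarrow> real. \<lbrakk>decseq h; \<forall>i. h i > 0; h \<longlonglongrightarrow> 0\<rbrakk> \<Longrightarrow> \<exists>i. P (h i)"
  shows "\<forall>\<^sub>F h in at_right 0. P h"
proof (rule ccontr)
  assume neg: "\<not> (\<forall>\<^sub>F h in at_right 0. P h)"
  have small: "\<exists>x>0. x < d \<and> \<not> P x" if "d > 0" for d :: real
    using neg that unfolding eventually_at_right_field by blast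
  have "\<exists>h. \<forall>n. (0 < h n \<and> h n < inverse (real (Suc n)) \<and> \<not> P (h n)) \<and> h (Suc n) \<le> h n"
  proof (rule dependent_nat_choice)
    show "\<exists>x. 0 < x \<and> x < inverse (real (Suc 0)) \<and> \<not> P x"
      using small[of 1] by auto
  next
    fix x :: real and n :: nat
    assume "0 < x \<and> x < inverse (real (Suc n)) \<and> \<not> P x"
    then have "min x (inverse (real (Suc (Suc n)))) > 0" by simp
    from small[OF this]
    show "\<exists>y. (0 < y \<and> y < inverse (real (Suc (Suc n))) \<and> \<not> P y) \<and> y \<le> x"
      by auto
  qed
  then obtain h where h: "\<And>n. 0 < h n" "\<And>n. h n < inverse (real (Suc n))" "\<And>n. \<not> P (h n)"
    "\<And>n. h (Suc n) \<le> h n"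
    by blast
  have "h \<longlonglongrightarrow> 0"
  proof (rule real_tendsto_sandwich[OF _ _ tendsto_const LIMSEQ_inverse_real_of_nat])
    show "\<forall>\<^sub>F n in sequentially. 0 \<le> h n"
      using h(1) by (simp add: less_imp_le)
    show "\<forall>\<^sub>F n in sequentially. h n \<le> inverse (real (Suc n))"
      using h(2) by (simp add: less_imp_le)
  qed
  with assms[of h] h show False
    by (auto simp: decseq_Suc_iff)
qed

lemma eventually_subset_of_outer_limit:
  fixes S :: "real \<Rightarrow> 'a::metric_space set"
  assumes lim: "\<And>h :: nat \<Rightarrow> real. \<lbrakk>decseq h; \<forall>i. h i > 0; h \<longlonglongrightarrow> 0\<rbrakk>
      \<Longrightarrow> outer_limit (\<lambda>i. S (h i)) \<subseteq> S0"
    and K: "compact K" and Q: "open Q" "S0 \<inter> K \<subseteq> Q"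
  shows "\<forall>\<^sub>F h in at_right 0. S h \<inter> K \<subseteq> Q"
proof (rule eventually_at_right_0_decseqI, rule ccontr)
  fix h :: "nat \<Rightarrow> real"
  assume h: "decseq h" "\<forall>i. h i > 0" "h \<longlonglongrightarrow> 0"
  assume "\<nexists>i. S (h i) \<inter> K \<subseteq> Q"
  then have "\<forall>i. \<exists>z. z \<in> S (h i) \<and> z \<in> K \<and> z \<notin> Q" by blast
  then obtain z where z: "\<And>i. z i \<in> S (h i)" "\<And>i. z i \<in> K" "\<And>i. z i \<notin> Q"
    by metis
  obtain l s where l: "l \<in> K" "strict_mono s" "(z \<circ> s) \<longlonglongrightarrow> l"
    using K z(2) unfolding compact_def by metis
  have "l \<in> outer_limit (\<lambda>i. S (h i))"
    unfolding outer_limit_def using l z(1) by (auto intro!: exI[of _ s] exI[of _ "z \<circ> s"])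
  with lim[OF h] l(1) Q have "l \<in> Q" by auto
  with l(3) \<open>open Q\<close> have "\<forall>\<^sub>F i in sequentially. (z \<circ> s) i \<in> Q"
    by (rule topological_tendstoD)
  with z(3) show False
    by simp
qed


section \<open>Single steps of a regular discretization\<close>

text \<open>The closed ball around \<open>F l\<close> is closed and convex. By continuity of \<open>F\<close> at \<open>l\<close> it contains all
  values of \<open>F\<close> near \<open>z (s i)\<close>, hence also their closed convex hull, in which regularity places
  the increment up to a vanishing error.\<close>

lemma flow_steps_converge:
  fixes H :: "'a::euclidean_space hybrid_system"
  assumes regular: "regular_discretization H Hh"
    and flow: "flow_map H = (\<lambda>z. {F z})"
    and F: "\<And>z. z \<in> flow_set H \<Longrightarrow> isCont F z"
    and K: "compact K"
    and h: "decseq h" "\<forall>i. h i > 0" "h \<longlonglongrightarrow> 0"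
    and z: "\<And>i. z i \<in> flow_set (Hh (h i))" "\<And>i. z i \<in> K"
    and w: "\<And>i. w i \<in> flow_map (Hh (h i)) (z i)"
  obtains l s where "l \<in> flow_set H" "l \<in> K" "strict_mono s" "(\<lambda>i. z (s i)) \<longlonglongrightarrow> l"
    "(\<lambda>i. (w (s i) - z (s i)) /\<^sub>R h (s i)) \<longlonglongrightarrow> F l"
proof -
  obtain l s where l: "l \<in> K" "strict_mono s" "(z \<circ> s) \<longlonglongrightarrow> l"
    using K z(2) unfolding compact_def by metis
  have "l \<in> outer_limit (\<lambda>i. flow_set (Hh (h i)))"
    unfolding outer_limit_def using l z(1) by (auto intro!: exI[of _ s] exI[of _ "z \<circ> s"])
  with regular h have lC: "l \<in> flow_set H"
    unfolding regular_discretization_def by blast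
  have zs: "(\<lambda>i. z (s i)) \<longlonglongrightarrow> l" using l(3) by (simp add: o_def)
  have hs: "(\<lambda>i. h (s i)) \<longlonglongrightarrow> 0"
    using LIMSEQ_subseq_LIMSEQ[OF h(3) l(2)] by (simp add: o_def)
  have "\<exists>\<rho> h0. class_K_infinity \<rho> \<and> h0 > 0 \<and>
          (\<forall>h\<in>{0<..h0}. \<forall>z \<in> flow_set (Hh h) \<inter> K.
             flow_map (Hh h) z \<subseteq>
               {z + h *\<^sub>R v + (h * \<rho> h) *\<^sub>R b | v b.
                  v \<in> closure (convex hull
                        (\<Union>b'\<in>cball 0 1. flow_map H (z + \<rho> h *\<^sub>R b'))) \<and>
                  b \<in> cball 0 1})"
    using regular K unfolding regular_discretization_def by blast
  then obtain \<rho> h0 where \<rho>: "class_K_infinity \<rho>" and h0: "h0 > 0"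
    and incl: "\<forall>h\<in>{0<..h0}. \<forall>z \<in> flow_set (Hh h) \<inter> K.
             flow_map (Hh h) z \<subseteq>
               {z + h *\<^sub>R v + (h * \<rho> h) *\<^sub>R b | v b.
                  v \<in> closure (convex hull
                        (\<Union>b'\<in>cball 0 1. flow_map H (z + \<rho> h *\<^sub>R b'))) \<and>
                  b \<in> cball 0 1}"
    by blast
  have \<rho>s: "(\<lambda>i. \<rho> (h (s i))) \<longlonglongrightarrow> 0"
  proof -
    have "continuous_on {0..} \<rho>" "\<rho> 0 = 0"
      using \<rho> by (auto simp: class_K_infinity_def)
    then show ?thesis
      using continuous_on_tendsto_compose[of "{0..}" \<rho> "\<lambda>i. h (s i)" 0 sequentially] hs h(2)
      by (simp add: less_imp_le)
  qed
  have "(\<lambda>i. (w (s i) - z (s i)) /\<^sub>R h (s i)) \<longlonglongrightarrow> F l"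
  proof (rule tendstoI)
    fix e :: real assume e: "e > 0"
    obtain d where d: "d > 0" "\<And>y. dist y l < d \<Longrightarrow> dist (F y) (F l) < e / 2"
      using F[OF lC] e unfolding continuous_at_eps_delta by (metis half_gt_zero)
    have ev1: "\<forall>\<^sub>F i in sequentially. dist (z (s i)) l < d / 2"
      using tendstoD[OF zs, of "d / 2"] d(1) by simp
    have "\<forall>\<^sub>F i in sequentially. dist (\<rho> (h (s i))) 0 < min (d / 2) (e / 2)"
      using tendstoD[OF \<rho>s, of "min (d / 2) (e / 2)"] d(1) e by simp
    then have ev2: "\<forall>\<^sub>F i in sequentially. \<bar>\<rho> (h (s i))\<bar> < min (d / 2) (e / 2)"
      by (simp add: dist_real_def)
    have ev3: "\<forall>\<^sub>F i in sequentially. h (s i) < h0"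
      using hs h0 by (rule order_tendstoD)
    show "\<forall>\<^sub>F i in sequentially. dist ((w (s i) - z (s i)) /\<^sub>R h (s i)) (F l) < e"
      using ev1 ev2 ev3
    proof eventually_elim
      case (elim i)
      define \<eta> where "\<eta> = h (s i)"
      have \<eta>: "\<eta> > 0" "\<eta> \<le> h0" using h(2) elim by (auto simp: \<eta>_def)
      have "h (s i) \<in> {0<..h0}" "z (s i) \<in> flow_set (Hh (h (s i))) \<inter> K"
        using \<eta> z by (auto simp: \<eta>_def)
      from subsetD[OF bspec[OF bspec[OF incl this(1)] this(2)] w[of "s i"]]
      obtain v b where vb: "w (s i) = z (s i) + \<eta> *\<^sub>R v + (\<eta> * \<rho> \<eta>) *\<^sub>R b" "b \<in> cball 0 1"
        and v: "v \<in> closure (convex hull (\<Union>b'\<in>cball 0 1. flow_map H (z (s i) + \<rho> \<eta> *\<^sub>R b')))"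
        unfolding \<eta>_def by blast
      have scale: "norm (\<rho> \<eta> *\<^sub>R b') \<le> \<bar>\<rho> \<eta>\<bar>" if "b' \<in> cball 0 1" for b' :: 'a
        using that mult_left_mono[of "norm b'" 1 "\<bar>\<rho> \<eta>\<bar>"] by simp
      have "(\<Union>b'\<in>cball 0 1. flow_map H (z (s i) + \<rho> \<eta> *\<^sub>R b')) \<subseteq> cball (F l) (e / 2)"
      proof (clarsimp simp: flow)
        fix b' :: 'a assume "norm b' \<le> 1"
        then have "norm (\<rho> \<eta> *\<^sub>R b') < d / 2"
          using scale[of b'] elim by (simp add: \<eta>_def)
        moreover have "dist (z (s i) + \<rho> \<eta> *\<^sub>R b') l \<le> dist (z (s i)) l + norm (\<rho> \<eta> *\<^sub>R b')"
          by (metis add.commute add_diff_cancel_left' add_le_cancel_right dist_commute dist_norm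
              dist_triangle)
        ultimately have "dist (z (s i) + \<rho> \<eta> *\<^sub>R b') l < d"
          using elim by linarith
        then show "dist (F l) (F (z (s i) + \<rho> \<eta> *\<^sub>R b')) * 2 \<le> e"
          using d(2) by (fastforce simp: dist_commute)
      qed
      then have "closure (convex hull (\<Union>b'\<in>cball 0 1. flow_map H (z (s i) + \<rho> \<eta> *\<^sub>R b')))
          \<subseteq> cball (F l) (e / 2)"
        by (meson closed_cball closure_minimal convex_cball hull_minimal)
      with v have "norm (v - F l) \<le> e / 2"
        by (auto simp: dist_norm norm_minus_commute)
      moreover have "norm (\<rho> \<eta> *\<^sub>R b) < e / 2"
        using scale[OF vb(2)] elim by (simp add: \<eta>_def)
      moreover have "(w (s i) - z (s i)) /\<^sub>R \<eta> = v + \<rho> \<eta> *\<^sub>R b"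
        using vb(1) \<eta>(1) by (simp add: algebra_simps)
      ultimately show ?case
        using norm_triangle_ineq[of "v - F l" "\<rho> \<eta> *\<^sub>R b"]
        by (simp add: dist_norm \<eta>_def[symmetric] algebra_simps)
    qed
  qed
  with that lC l zs show ?thesis by blast
qed

text \<open>Local boundedness supplies a convergent subsequence of the successors; graphical
  convergence then identifies its limit.\<close>

lemma jump_steps_converge:
  fixes H :: "'a::euclidean_space hybrid_system"
  assumes regular: "regular_discretization H Hh"
    and bounded: "jumps_locally_eventually_bounded Hh"
    and jump: "jump_map H = (\<lambda>z. {G z})"
    and K: "compact K"
    and h: "decseq h" "\<forall>i. h i > 0" "h \<longlonglongrightarrow> 0"
    and z: "\<And>i. z i \<in> jump_set (Hh (h i))" "\<And>i. z i \<in> K"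
    and w: "\<And>i. w i \<in> jump_map (Hh (h i)) (z i)"
  obtains l s where "l \<in> jump_set H" "l \<in> K" "strict_mono s" "(\<lambda>i. z (s i)) \<longlonglongrightarrow> l"
    "(\<lambda>i. w (s i)) \<longlonglongrightarrow> G l"
proof -
  obtain h0 where h0: "h0 > 0"
    and bdd: "bounded (\<Union>h\<in>{0<..h0}. \<Union>z \<in> jump_set (Hh h) \<inter> K. jump_map (Hh h) z)"
    using bounded K unfolding jumps_locally_eventually_bounded_def by blast
  define B where "B = closure (\<Union>h\<in>{0<..h0}. \<Union>z \<in> jump_set (Hh h) \<inter> K. jump_map (Hh h) z)"
  have "compact (K \<times> B)"
    using K bdd by (simp add: B_def compact_closure compact_Times)
  have "\<forall>\<^sub>F i in sequentially. h i < h0"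
    using h(3) h0 by (rule order_tendstoD)
  then obtain N where N: "\<And>i. i \<ge> N \<Longrightarrow> h i < h0"
    by (auto simp: eventually_sequentially)
  have inB: "(z (i + N), w (i + N)) \<in> K \<times> B" for i
  proof -
    have "h (i + N) \<in> {0<..h0}" using N[of "i + N"] h(2) by (simp add: less_imp_le)
    with z[of "i + N"] w[of "i + N"]
    have "w (i + N) \<in> (\<Union>h\<in>{0<..h0}. \<Union>z \<in> jump_set (Hh h) \<inter> K. jump_map (Hh h) z)"
      by blast
    then have "w (i + N) \<in> B" unfolding B_def by (rule subsetD[OF closure_subset])
    with z(2) show ?thesis by blast
  qed
  obtain p t where p: "p \<in> K \<times> B" "strict_mono t"
    "((\<lambda>i. (z (i + N), w (i + N))) \<circ> t) \<longlonglongrightarrow> p"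
    using \<open>compact (K \<times> B)\<close>[unfolded compact_def, THEN spec, of "\<lambda>i. (z (i + N), w (i + N))"]
      inB by blast
  define s where "s i = t i + N" for i
  have s: "strict_mono s" using p(2) by (simp add: s_def strict_mono_def)
  have lim: "(\<lambda>i. (z (s i), w (s i))) \<longlonglongrightarrow> p"
    using p(3) by (simp add: s_def o_def)
  have zs: "(\<lambda>i. z (s i)) \<longlonglongrightarrow> fst p" and ws: "(\<lambda>i. w (s i)) \<longlonglongrightarrow> snd p"
    using tendsto_fst[OF lim] tendsto_snd[OF lim] by simp_all
  have "p \<in> outer_limit (\<lambda>i. graph (jump_map (Hh (h i))))"
    unfolding outer_limit_def graph_def using s lim w
    by (auto intro!: exI[of _ s] exI[of _ "\<lambda>i. (z (s i), w (s i))"])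
  moreover have "outer_limit (\<lambda>i. graph (jump_map (Hh (h i)))) = graph (jump_map H)"
    using regular h unfolding regular_discretization_def is_graphical_limit_def by blast
  ultimately have "snd p = G (fst p)"
    by (auto simp: graph_def jump)
  moreover have "fst p \<in> outer_limit (\<lambda>i. jump_set (Hh (h i)))"
    unfolding outer_limit_def using s zs z(1)
    by (auto intro!: exI[of _ s] exI[of _ "\<lambda>i. z (s i)"])
  then have "fst p \<in> jump_set H"
    using regular h unfolding regular_discretization_def by blast
  ultimately show ?thesis
    using that[of "fst p" s] s zs ws p(1) by auto
qed

lemma eventually_flow_step_in:
  fixes H :: "'a::euclidean_space hybrid_system"
  assumes regular: "regular_discretization H Hh"
    and flow: "flow_map H = (\<lambda>z. {F z})"
    and F: "\<And>z. z \<in> flow_set H \<Longrightarrow> isCont F z"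
    and K: "compact K"
    and P: "open P" "\<And>z. z \<in> flow_set H \<Longrightarrow> z \<in> K \<Longrightarrow> z \<in> P"
  shows "\<forall>\<^sub>F h in at_right 0. \<forall>z\<in>flow_set (Hh h) \<inter> K. \<forall>w\<in>flow_map (Hh h) z. w \<in> P"
proof (rule eventually_at_right_0_decseqI, rule ccontr)
  fix h :: "nat \<Rightarrow> real"
  assume h: "decseq h" "\<forall>i. h i > 0" "h \<longlonglongrightarrow> 0"
  assume "\<nexists>i. \<forall>z\<in>flow_set (Hh (h i)) \<inter> K. \<forall>w\<in>flow_map (Hh (h i)) z. w \<in> P"
  then have "\<forall>i. \<exists>z w. z \<in> flow_set (Hh (h i)) \<and> z \<in> K \<and> w \<in> flow_map (Hh (h i)) z \<and> w \<notin> P"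
    by blast
  then obtain z w where zw: "\<And>i. z i \<in> flow_set (Hh (h i))" "\<And>i. z i \<in> K"
      "\<And>i. w i \<in> flow_map (Hh (h i)) (z i)" "\<And>i. w i \<notin> P"
    by metis
  obtain l s where l: "l \<in> flow_set H" "l \<in> K" "strict_mono s" "(\<lambda>i. z (s i)) \<longlonglongrightarrow> l"
    "(\<lambda>i. (w (s i) - z (s i)) /\<^sub>R h (s i)) \<longlonglongrightarrow> F l"
    by (rule flow_steps_converge[OF regular flow F K h zw(1-3)]) auto
  have "(\<lambda>i. h (s i)) \<longlonglongrightarrow> 0"
    using LIMSEQ_subseq_LIMSEQ[OF h(3) l(3)] by (simp add: o_def)
  from tendsto_add[OF l(4) tendsto_scaleR[OF this l(5)]]
  have "(\<lambda>i. z (s i) + h (s i) *\<^sub>R ((w (s i) - z (s i)) /\<^sub>R h (s i))) \<longlonglongrightarrow> l" by simp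
  moreover have "z (s i) + h (s i) *\<^sub>R ((w (s i) - z (s i)) /\<^sub>R h (s i)) = w (s i)" for i
    using h(2)[rule_format, of "s i"] by simp
  ultimately have "(\<lambda>i. w (s i)) \<longlonglongrightarrow> l" by simp
  from topological_tendstoD[OF this P(1) P(2)[OF l(1,2)]]
  have "\<forall>\<^sub>F i in sequentially. w (s i) \<in> P" .
  with zw(4) show False by simp
qed

text \<open>The set \<open>P\<close> consists of pairs so that the successor can be compared with the point before
  the jump.\<close>

lemma eventually_jump_step_in:
  fixes H :: "'a::euclidean_space hybrid_system"
  assumes regular: "regular_discretization H Hh"
    and bounded: "jumps_locally_eventually_bounded Hh"
    and jump: "jump_map H = (\<lambda>z. {G z})"
    and K: "compact K"
    and P: "open P" "\<And>z. z \<in> jump_set H \<Longrightarrow> z \<in> K \<Longrightarrow> (z, G z) \<in> P"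
  shows "\<forall>\<^sub>F h in at_right 0. \<forall>z\<in>jump_set (Hh h) \<inter> K. \<forall>w\<in>jump_map (Hh h) z. (z, w) \<in> P"
proof (rule eventually_at_right_0_decseqI, rule ccontr)
  fix h :: "nat \<Rightarrow> real"
  assume h: "decseq h" "\<forall>i. h i > 0" "h \<longlonglongrightarrow> 0"
  assume "\<nexists>i. \<forall>z\<in>jump_set (Hh (h i)) \<inter> K. \<forall>w\<in>jump_map (Hh (h i)) z. (z, w) \<in> P"
  then have "\<forall>i. \<exists>z w. z \<in> jump_set (Hh (h i)) \<and> z \<in> K \<and> w \<in> jump_map (Hh (h i)) z \<and> (z, w) \<notin> P"
    by blast
  then obtain z w where zw: "\<And>i. z i \<in> jump_set (Hh (h i))" "\<And>i. z i \<in> K"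
      "\<And>i. w i \<in> jump_map (Hh (h i)) (z i)" "\<And>i. (z i, w i) \<notin> P"
    by metis
  obtain l s where l: "l \<in> jump_set H" "l \<in> K" "strict_mono s" "(\<lambda>i. z (s i)) \<longlonglongrightarrow> l"
    "(\<lambda>i. w (s i)) \<longlonglongrightarrow> G l"
    by (rule jump_steps_converge[OF regular bounded jump K h zw(1-3)]) auto
  have "\<forall>\<^sub>F i in sequentially. (z (s i), w (s i)) \<in> P"
    by (rule topological_tendstoD[OF tendsto_Pair[OF l(4,5)] P(1) P(2)[OF l(1,2)]])
  with zw(4) show False by simp
qed

lemma GDERIV_along_line:
  assumes "GDERIV f (x + t *\<^sub>R v) :> g"
  shows "((\<lambda>t. f (x + t *\<^sub>R v)) has_real_derivative g \<bullet> v) (at t)"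
proof -
  have "((\<lambda>t. x + t *\<^sub>R v) has_derivative (\<lambda>h. h *\<^sub>R v)) (at t)"
    by (auto intro!: derivative_eq_intros)
  from has_derivative_compose[OF this assms[unfolded gderiv_def]]
  show ?thesis
    by (rule has_derivative_imp_has_field_derivative) (simp add: inner_commute)
qed

text \<open>The mean value theorem evaluates the gradient of \<open>W\<close> at a point between \<open>z\<close> and \<open>w\<close>.
  Along a sequence of violations this point has the same limit as \<open>z\<close>, which makes the rate of
  \<open>W\<close> along the flow at that limit at least \<open>- \<kappa>\<close>.\<close>

lemma eventually_flow_step_decreases:
  fixes H :: "'a::euclidean_space hybrid_system" and W :: "'a \<Rightarrow> real"
  assumes regular: "regular_discretization H Hh"
    and flow: "flow_map H = (\<lambda>z. {F z})"
    and F: "\<And>z. z \<in> flow_set H \<Longrightarrow> isCont F z"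
    and K: "compact K"
    and W: "\<And>z. GDERIV W z :> gW z" "continuous_on UNIV gW"
    and decr: "\<And>z. z \<in> flow_set H \<Longrightarrow> z \<in> K \<Longrightarrow> gW z \<bullet> F z < - \<kappa>"
  shows "\<forall>\<^sub>F h in at_right 0. \<forall>z\<in>flow_set (Hh h) \<inter> K. \<forall>w\<in>flow_map (Hh h) z. W w \<le> W z - h * \<kappa>"
proof (rule eventually_at_right_0_decseqI, rule ccontr)
  fix h :: "nat \<Rightarrow> real"
  assume h: "decseq h" "\<forall>i. h i > 0" "h \<longlonglongrightarrow> 0"
  assume "\<nexists>i. \<forall>z\<in>flow_set (Hh (h i)) \<inter> K. \<forall>w\<in>flow_map (Hh (h i)) z. W w \<le> W z - h i * \<kappa>"
  then have "\<forall>i. \<exists>z w. z \<in> flow_set (Hh (h i)) \<and> z \<in> K \<and> w \<in> flow_map (Hh (h i)) z \<and>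
      W w > W z - h i * \<kappa>"
    by (metis IntE linorder_not_less)
  then obtain z w where zw: "\<And>i. z i \<in> flow_set (Hh (h i))" "\<And>i. z i \<in> K"
      "\<And>i. w i \<in> flow_map (Hh (h i)) (z i)" "\<And>i. W (w i) > W (z i) - h i * \<kappa>"
    by metis
  obtain l s where l: "l \<in> flow_set H" "l \<in> K" "strict_mono s" "(\<lambda>i. z (s i)) \<longlonglongrightarrow> l"
    "(\<lambda>i. (w (s i) - z (s i)) /\<^sub>R h (s i)) \<longlonglongrightarrow> F l"
    by (rule flow_steps_converge[OF regular flow F K h zw(1-3)]) auto
  define v where "v i = (w (s i) - z (s i)) /\<^sub>R h (s i)" for i
  have hpos: "h (s i) > 0" for i using h(2) by blast
  have w_eq: "w (s i) = z (s i) + h (s i) *\<^sub>R v i" for i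
    using hpos[of i] by (simp add: v_def)
  have v: "v \<longlonglongrightarrow> F l" using l(5) by (simp add: v_def[abs_def])
  have hs: "(\<lambda>i. h (s i)) \<longlonglongrightarrow> 0"
    using LIMSEQ_subseq_LIMSEQ[OF h(3) l(3)] by (simp add: o_def)
  have "\<exists>t. 0 < t \<and> t < h (s i) \<and>
      W (w (s i)) - W (z (s i)) = h (s i) * (gW (z (s i) + t *\<^sub>R v i) \<bullet> v i)" for i
  proof -
    have "((\<lambda>t. W (z (s i) + t *\<^sub>R v i)) has_real_derivative gW (z (s i) + t *\<^sub>R v i) \<bullet> v i) (at t)"
      for t
      by (rule GDERIV_along_line[OF W(1)])
    from MVT2[OF hpos this] show ?thesis
      using w_eq[of i] by auto
  qed
  then obtain t where t: "\<And>i. 0 < t i" "\<And>i. t i < h (s i)"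
    "\<And>i. W (w (s i)) - W (z (s i)) = h (s i) * (gW (z (s i) + t i *\<^sub>R v i) \<bullet> v i)"
    by metis
  have "t \<longlonglongrightarrow> 0"
    by (rule real_tendsto_sandwich[OF _ _ tendsto_const hs]) (use t in \<open>auto intro!: always_eventually less_imp_le\<close>)
  from tendsto_add[OF l(4) tendsto_scaleR[OF this v]]
  have "(\<lambda>i. z (s i) + t i *\<^sub>R v i) \<longlonglongrightarrow> l" by simp
  then have "(\<lambda>i. gW (z (s i) + t i *\<^sub>R v i)) \<longlonglongrightarrow> gW l"
    using continuous_on_tendsto_compose[OF W(2), of _ l sequentially] by simp
  from tendsto_inner[OF this v]
  have "(\<lambda>i. gW (z (s i) + t i *\<^sub>R v i) \<bullet> v i) \<longlonglongrightarrow> gW l \<bullet> F l" .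
  moreover have "gW (z (s i) + t i *\<^sub>R v i) \<bullet> v i \<ge> - \<kappa>" for i
  proof -
    have "h (s i) * (gW (z (s i) + t i *\<^sub>R v i) \<bullet> v i) > h (s i) * (- \<kappa>)"
      using t(3)[of i] zw(4)[of "s i"] by simp
    then show ?thesis using hpos[of i] by (simp only: mult_less_cancel_left_pos less_imp_le)
  qed
  ultimately have "gW l \<bullet> F l \<ge> - \<kappa>"
    by (intro tendsto_lowerbound[where F = sequentially]) auto
  with decr l show False by fastforce
qed


section \<open>Weak decrease and an auxiliary function\<close>

lemma continuous_on_compact_positive_lower_bound:
  fixes g :: "'a::topological_space \<Rightarrow> real"
  assumes "compact K" "continuous_on K g" "\<And>z. z \<in> K \<Longrightarrow> g z > 0"
  obtains m where "m > 0" "\<And>z. z \<in> K \<Longrightarrow> m \<le> g z"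
proof (cases "K = {}")
  case True
  then show ?thesis using that[of 1] by simp
next
  case False
  with continuous_attains_inf[OF assms(1) False assms(2)] assms(3) that show ?thesis
    by metis
qed

text \<open>Where \<open>q \<ge> 0\<close>, compactness bounds \<open>p\<close> away from \<open>0\<close>, and a small multiple of \<open>q\<close> cannot
  undo this; elsewhere both summands help.\<close>

lemma strict_decrease_of_weak_and_auxiliary:
  fixes p q :: "'a::t2_space \<Rightarrow> real"
  assumes K: "compact K" and cont: "continuous_on K p" "continuous_on K q"
    and p: "\<And>z. z \<in> K \<Longrightarrow> p z \<le> 0" and q: "\<And>z. z \<in> K \<Longrightarrow> p z = 0 \<Longrightarrow> q z < 0"
  obtains d0 where "d0 > 0"
    "\<And>d. 0 < d \<Longrightarrow> d \<le> d0 \<Longrightarrow> \<exists>\<kappa>>0. \<forall>z\<in>K. p z + d * q z < - \<kappa>"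
proof -
  define K' where "K' = {z \<in> K. 0 \<le> q z}"
  have K': "compact K'"
  proof -
    have eq: "K' = K \<inter> q -` {0..}" by (auto simp: K'_def)
    have "closed K'" unfolding eq
      by (rule continuous_closed_preimage[OF cont(2) compact_imp_closed[OF K] closed_atLeast])
    with K have "compact (K \<inter> K')" by (rule compact_Int_closed)
    moreover have "K \<inter> K' = K'" by (auto simp: K'_def)
    ultimately show ?thesis by simp
  qed
  have sub: "K' \<subseteq> K" by (auto simp: K'_def)
  obtain m where m: "m > 0" "\<And>z. z \<in> K' \<Longrightarrow> m \<le> - p z"
  proof (rule continuous_on_compact_positive_lower_bound[OF K', of "\<lambda>z. - p z"])
    show "continuous_on K' (\<lambda>z. - p z)"
      using continuous_on_subset[OF cont(1) sub] by (intro continuous_intros)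
    show "- p z > 0" if "z \<in> K'" for z
      using that p[of z] q[of z] by (cases "p z = 0") (auto simp: K'_def)
  qed blast
  have "bounded (q ` K)"
    using compact_continuous_image[OF cont(2) K] by (rule compact_imp_bounded)
  then obtain M where M: "M > 0" "\<And>z. z \<in> K \<Longrightarrow> \<bar>q z\<bar> \<le> M"
    unfolding bounded_pos by auto
  show ?thesis
  proof (rule that[of "m / (2 * M)"])
    show "m / (2 * M) > 0" using m M by simp
    fix d :: real assume d: "0 < d" "d \<le> m / (2 * M)"
    have neg: "0 < - (p z + d * q z)" if z: "z \<in> K" for z
    proof (cases "0 \<le> q z")
      case True
      then have "p z \<le> - m" using m(2)[of z] z by (auto simp: K'_def)
      moreover have "d * q z \<le> m / (2 * M) * M"
        using d M(2)[OF z] True M(1) m(1) by (intro mult_mono) auto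
      ultimately show ?thesis using m(1) M(1) by simp
    next
      case False
      then show ?thesis using p[OF z] d(1) mult_pos_neg[of d "q z"] by simp
    qed
    obtain k where k: "k > 0" "\<And>z. z \<in> K \<Longrightarrow> k \<le> - (p z + d * q z)"
      by (rule continuous_on_compact_positive_lower_bound[OF K, of "\<lambda>z. - (p z + d * q z)"])
         (use neg cont in \<open>auto intro!: continuous_intros\<close>)
    show "\<exists>\<kappa>>0. \<forall>z\<in>K. p z + d * q z < - \<kappa>"
    proof (intro exI[of _ "k / 2"] conjI ballI)
      show "k / 2 > 0" using k(1) by simp
      show "p z + d * q z < - (k / 2)" if "z \<in> K" for z
        using k(2)[OF that] k(1) by simp
    qed
  qed
qed


section \<open>Induction along solutions of discretized systems\<close>

text \<open>The last point \<open>(K, J)\<close> of the staircase is preceded by a flow step if \<open>K\<close> lies strictly to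
  the right of where level \<open>J\<close> begins, and by a jump otherwise.\<close>

lemma discrete_time_domain_predecessor:
  assumes E: "discrete_time_domain E" and KJ: "(K, J) \<in> E"
  shows "(K = 0 \<and> J = 0) \<or> (\<exists>k. K = Suc k \<and> (k, J) \<in> E) \<or> (\<exists>j. J = Suc j \<and> (K, j) \<in> E)"
proof -
  obtain \<kappa> :: "nat \<Rightarrow> nat" where \<kappa>: "\<kappa> 0 = 0" "\<And>j. j \<le> J \<Longrightarrow> \<kappa> j \<le> \<kappa> (Suc j)"
    and eq: "E \<inter> ({0..K} \<times> {0..J}) = (\<Union>j\<in>{0..J}. {\<kappa> j..\<kappa> (Suc j)} \<times> {j})"
    using bspec[OF E[unfolded discrete_time_domain_def] KJ] by auto
  have mem: "(k, j) \<in> E \<longleftrightarrow> \<kappa> j \<le> k \<and> k \<le> \<kappa> (Suc j)" if "k \<le> K" "j \<le> J" for k j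
    using arg_cong[OF eq, of "\<lambda>X. (k, j) \<in> X"] that by auto
  have K: "\<kappa> J \<le> K" "K \<le> \<kappa> (Suc J)" using mem[of K J] KJ by auto
  show ?thesis
  proof (cases "\<kappa> J < K")
    case True
    then obtain k where "K = Suc k" by (cases K) auto
    with True K mem[of k J] show ?thesis by auto
  next
    case False
    with K have "\<kappa> J = K" by simp
    with \<kappa>(1) \<kappa>(2)[of "J - 1"] mem[of K "J - 1"] show ?thesis
      by (cases J) auto
  qed
qed

lemma discrete_solution_induct [consumes 2, case_names init flow jump]:
  assumes sol: "discrete_solution H E z" and "(k, j) \<in> E"
    and init: "P 0 0"
    and flow: "\<And>k j. \<lbrakk>P k j; z (k, j) \<in> flow_set H; z (Suc k, j) \<in> flow_map H (z (k, j))\<rbrakk>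
      \<Longrightarrow> P (Suc k) j"
    and jump: "\<And>k j. \<lbrakk>P k j; z (k, j) \<in> jump_set H; z (k, Suc j) \<in> jump_map H (z (k, j))\<rbrakk>
      \<Longrightarrow> P k (Suc j)"
  shows "P k j"
  using \<open>(k, j) \<in> E\<close>
proof (induction "k + j" arbitrary: k j rule: less_induct)
  case less
  have dom: "discrete_time_domain E" using sol by (simp add: discrete_solution_def)
  have flow_rule: "z (k, j) \<in> flow_set H \<and> z (Suc k, j) \<in> flow_map H (z (k, j))"
    if "(k, j) \<in> E" "(Suc k, j) \<in> E" for k j
    using sol that by (simp add: discrete_solution_def)
  have jump_rule: "z (k, j) \<in> jump_set H \<and> z (k, Suc j) \<in> jump_map H (z (k, j))"
    if "(k, j) \<in> E" "(k, Suc j) \<in> E" for k j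
    using sol that by (simp add: discrete_solution_def)
  consider "k = 0" "j = 0" | k' where "k = Suc k'" "(k', j) \<in> E" | j' where "j = Suc j'" "(k, j') \<in> E"
    using discrete_time_domain_predecessor[OF dom less.prems] by blast
  then show ?case
  proof cases
    case 1
    then show ?thesis using init by simp
  next
    case (2 k')
    have "P k' j" using 2 by (intro less.hyps) auto
    with flow_rule[of k' j] 2 less.prems flow[of k' j] show ?thesis by simp
  next
    case (3 j')
    have "P k j'" using 3 by (intro less.hyps) auto
    with jump_rule[of k j'] 3 less.prems jump[of k j'] show ?thesis by simp
  qed
qed


section \<open>Practical stability of regular discretizations\<close>

text \<open>The factor \<open>d\<close> in \<open>W = V + d U\<close> depends on the compact set between the two energy
  levels, so \<open>W\<close> need neither be positive definite nor have compact sublevel sets. Confinement is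
  therefore read off from \<open>V\<close>, which differs from \<open>W\<close> by at most \<open>s\<close> on \<open>K\<close>. As points of the
  discretization may lie outside the flow set, compactness is required on a thickening of
  it.\<close>

lemma practical_stability_of_regular_discretization:
  fixes H :: "'a::euclidean_space hybrid_system" and V U :: "'a \<Rightarrow> real"
  assumes regular: "regular_discretization H Hh"
    and bounded: "jumps_locally_eventually_bounded Hh"
    and flow: "flow_map H = (\<lambda>z. {F z})" and jump: "jump_map H = (\<lambda>z. {G z})"
    and sets: "closed (flow_set H)" "closed (jump_set H)" "jump_set H \<subseteq> flow_set H"
    and F: "\<And>z. z \<in> flow_set H \<Longrightarrow> isCont F z"
    and G: "continuous_on UNIV G" "\<And>z. z \<in> jump_set H \<Longrightarrow> G z \<in> flow_set H"
    and V: "\<And>z. GDERIV V z :> gV z" "continuous_on UNIV gV"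
    and U: "\<And>z. GDERIV U z :> gU z" "continuous_on UNIV gU"
    and V_nonneg: "\<And>z. V z \<ge> 0"
    and A: "A = {z \<in> flow_set H. V z = 0}" "A \<noteq> {}"
    and proper: "\<sigma> > 0" "\<And>v. compact {z. infdist z (flow_set H) \<le> \<sigma> \<and> V z \<le> v}"
    and flow_weak: "\<And>z. z \<in> flow_set H \<Longrightarrow> gV z \<bullet> F z \<le> 0"
    and flow_aux: "\<And>z. \<lbrakk>z \<in> flow_set H; z \<notin> A; gV z \<bullet> F z = 0\<rbrakk> \<Longrightarrow> gU z \<bullet> F z < 0"
    and jump_weak: "\<And>z. z \<in> jump_set H \<Longrightarrow> V (G z) \<le> V z"
    and jump_aux: "\<And>z. \<lbrakk>z \<in> jump_set H; z \<notin> A; V (G z) = V z\<rbrakk> \<Longrightarrow> U (G z) < U z"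
    and r: "r > 0" and \<epsilon>: "\<epsilon> > 0"
  shows "\<exists>hs>0. \<forall>h\<in>{0<..<hs}. \<exists>T>0. \<forall>E z.
           discrete_solution (Hh h) E z \<and> infdist (z (0, 0)) A \<le> r \<longrightarrow>
           (\<forall>(k, j) \<in> E. real k * h + real j \<ge> T \<longrightarrow> infdist (z (k, j)) A \<le> \<epsilon>)"
proof -
  let ?C = "flow_set H" and ?D = "jump_set H"
  define S where "S v = {z. infdist z ?C \<le> \<sigma> \<and> V z \<le> v}" for v
  have S: "compact (S v)" for v using proper(2) by (simp add: S_def)
  have C_ne: "?C \<noteq> {}" using A by auto
  have dist0: "infdist z ?C = 0 \<longleftrightarrow> z \<in> ?C" for z
    using in_closed_iff_infdist_zero[OF sets(1) C_ne] by simp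
  have contV: "continuous_on X V" and contU: "continuous_on X U" for X
    using V(1) U(1) unfolding gderiv_def
    by (auto intro!: continuous_at_imp_continuous_on has_derivative_continuous)
  have contG: "continuous_on X G" for X using G(1) continuous_on_subset by blast
  have contF: "continuous_on (?C \<inter> X) F" for X
    using F by (auto intro!: continuous_at_imp_continuous_on)
  have contgV: "continuous_on X gV" and contgU: "continuous_on X gU" for X
    using V(2) U(2) continuous_on_subset by blast+

  \<comment> \<open>Near the flow set, energy at most \<open>p\<close> forces distance at most \<open>\<epsilon>\<close> from the attractor.\<close>
  obtain p where p: "0 < p" "p \<le> 1" "p \<le> \<sigma>"
    and p_eps: "\<And>z. \<lbrakk>infdist z ?C < p; V z \<le> p\<rbrakk> \<Longrightarrow> infdist z A \<le> \<epsilon>"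
  proof -
    define B where "B = S 1 \<inter> {z. \<epsilon> \<le> infdist z A}"
    have B: "compact B" unfolding B_def
      by (intro compact_Int_closed S closed_Collect_le continuous_intros)
    have pos: "0 < V z + infdist z ?C" if "z \<in> B" for z
    proof (rule ccontr)
      assume "\<not> 0 < V z + infdist z ?C"
      then have "V z = 0" "infdist z ?C = 0"
        using V_nonneg[of z] infdist_nonneg[of z ?C] by linarith+
      then have "z \<in> A" using A(1) dist0 by simp
      with that \<epsilon> show False by (simp add: B_def)
    qed
    have "continuous_on B (\<lambda>z. V z + infdist z ?C)"
      by (intro continuous_intros contV)
    from continuous_on_compact_positive_lower_bound[OF B this pos]
    obtain m where m: "m > 0" "\<And>z. z \<in> B \<Longrightarrow> m \<le> V z + infdist z ?C"
      by blast
    show ?thesis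
    proof (rule that[of "min (min 1 \<sigma>) (m / 2)"])
      fix z assume "infdist z ?C < min (min 1 \<sigma>) (m / 2)" "V z \<le> min (min 1 \<sigma>) (m / 2)"
      then show "infdist z A \<le> \<epsilon>"
        using m(2)[of z] by (fastforce simp: B_def S_def)
    qed (use m proper(1) in auto)
  qed

  obtain R where R: "R \<ge> 0" "\<And>z. infdist z A \<le> r \<Longrightarrow> V z \<le> R"
    and Kr: "compact {z. infdist z A \<le> r}"
  proof -
    have "A = S 0 \<inter> ?C"
      using V_nonneg proper(1) infdist_zero[of _ ?C] by (auto simp: A(1) S_def intro: antisym)
    then have "compact A" using S sets(1) compact_Int_closed by metis
    from compact_infdist_le[OF A(2) this r] have "compact {z. infdist z A \<le> r}" .
    moreover from this have "bounded (V ` {z. infdist z A \<le> r})"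
      by (intro compact_imp_bounded compact_continuous_image contV)
    then obtain R where "R > 0" "\<forall>z\<in>{z. infdist z A \<le> r}. \<bar>V z\<bar> \<le> R"
      unfolding bounded_pos by auto
    ultimately show ?thesis using that[of R] by fastforce
  qed

  define K where "K = S (R + 3)"
  define K1 where "K1 = S (R + 2) \<inter> {z. p / 4 \<le> V z}"
  have K1: "compact K1" unfolding K1_def
    by (intro compact_Int_closed S closed_Collect_le continuous_intros contV)
  have K1_not_A: "z \<notin> A" if "z \<in> K1" for z
    using that p(1) by (auto simp: K1_def A(1))

  obtain d1 where d1: "d1 > 0" "\<And>d. 0 < d \<Longrightarrow> d \<le> d1 \<Longrightarrow>
      \<exists>\<kappa>>0. \<forall>z\<in>?C \<inter> K1. gV z \<bullet> F z + d * (gU z \<bullet> F z) < - \<kappa>"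
  proof (rule strict_decrease_of_weak_and_auxiliary
      [of "?C \<inter> K1" "\<lambda>z. gV z \<bullet> F z" "\<lambda>z. gU z \<bullet> F z"])
    show "compact (?C \<inter> K1)" using sets(1) K1 by (rule closed_Int_compact)
    show "continuous_on (?C \<inter> K1) (\<lambda>z. gV z \<bullet> F z)" "continuous_on (?C \<inter> K1) (\<lambda>z. gU z \<bullet> F z)"
      by (intro continuous_intros contF contgV contgU)+
  qed (use flow_weak flow_aux K1_not_A in blast)+
  obtain d2 where d2: "d2 > 0" "\<And>d. 0 < d \<Longrightarrow> d \<le> d2 \<Longrightarrow>
      \<exists>\<kappa>>0. \<forall>z\<in>?D \<inter> K1. (V (G z) - V z) + d * (U (G z) - U z) < - \<kappa>"
  proof (rule strict_decrease_of_weak_and_auxiliary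
      [of "?D \<inter> K1" "\<lambda>z. V (G z) - V z" "\<lambda>z. U (G z) - U z"])
    show "compact (?D \<inter> K1)" using sets(2) K1 by (rule closed_Int_compact)
    show "continuous_on (?D \<inter> K1) (\<lambda>z. V (G z) - V z)" "continuous_on (?D \<inter> K1) (\<lambda>z. U (G z) - U z)"
      by (intro continuous_intros continuous_on_compose2[OF contV[of UNIV] contG]
          continuous_on_compose2[OF contU[of UNIV] contG] contV contU; simp)+
  qed (use jump_weak jump_aux K1_not_A in force)+
  have "bounded (U ` K)"
    unfolding K_def by (intro compact_imp_bounded compact_continuous_image contU S)
  then obtain M where M: "M > 0" "\<And>z. z \<in> K \<Longrightarrow> \<bar>U z\<bar> \<le> M"
    unfolding bounded_pos by auto
  \<comment> \<open>The target level for \<open>W\<close> is \<open>e = p / 2 + s\<close>, defined below; then \<open>W \<le> e\<close> gives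
    \<open>V \<le> e + s = 3 p / 4\<close>.\<close>
  define s where "s = p / 8"
  define d where "d = min (min d1 d2) (s / M)"
  have d: "0 < d" "d \<le> d1" "d \<le> d2" "d \<le> s / M"
    using d1(1) d2(1) M(1) p(1) by (auto simp: d_def s_def)
  define W where "W z = V z + d * U z" for z
  have WV: "\<bar>W z - V z\<bar> \<le> s" if "z \<in> K" for z
  proof -
    have "\<bar>W z - V z\<bar> = d * \<bar>U z\<bar>" using d(1) by (simp add: W_def abs_mult)
    also have "\<dots> \<le> s / M * M"
      using d M(2)[OF that] M(1) p(1) by (intro mult_mono) (auto simp: s_def)
    finally show ?thesis using M(1) by simp
  qed
  define gW where "gW z = gV z + d *\<^sub>R gU z" for z
  have gW: "GDERIV W z :> gW z" for z
    using V(1)[of z] U(1)[of z] unfolding gderiv_def W_def gW_def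
    by (auto intro!: derivative_eq_intros simp: inner_add_right)
  have contgW: "continuous_on UNIV gW"
    unfolding gW_def by (intro continuous_intros contgV contgU)
  have contW: "continuous_on X W" for X
    unfolding W_def by (intro continuous_intros contV contU)
  obtain \<kappa>1 where \<kappa>1: "\<kappa>1 > 0" "\<forall>z\<in>?C \<inter> K1. gV z \<bullet> F z + d * (gU z \<bullet> F z) < - \<kappa>1"
    using d1(2) d by blast
  obtain \<kappa>2 where \<kappa>2: "\<kappa>2 > 0" "\<forall>z\<in>?D \<inter> K1. (V (G z) - V z) + d * (U (G z) - U z) < - \<kappa>2"
    using d2(2) d by blast
  define \<kappa> where "\<kappa> = min \<kappa>1 \<kappa>2"
  have \<kappa>: "\<kappa> > 0" using \<kappa>1 \<kappa>2 by (simp add: \<kappa>_def)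
  define e where "e = p / 2 + s"
  \<comment> \<open>Steps from energy at most \<open>R + 2\<close> land in the open set \<open>Q \<subseteq> K\<close>. There \<open>W\<close> is close to
    \<open>V\<close>, and the bound on \<open>W\<close> brings the energy back to at most \<open>R + 2\<close>.\<close>
  define Q where "Q = {w. infdist w ?C < p} \<inter> {w. V w < R + 3}"
  have openQ: "open Q" unfolding Q_def
    by (intro open_Int open_Collect_less continuous_intros contV)
  have Q_K: "w \<in> K" if "w \<in> Q" for w
    using that p by (auto simp: Q_def K_def S_def)

  have flow_Q: "\<forall>\<^sub>F h in at_right 0. \<forall>z\<in>flow_set (Hh h) \<inter> S (R + 2). \<forall>w\<in>flow_map (Hh h) z. w \<in> Q"
    by (rule eventually_flow_step_in[OF regular flow F S openQ])
       (use p dist0 in \<open>auto simp: Q_def S_def\<close>)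
  have flow_small: "\<forall>\<^sub>F h in at_right 0. \<forall>z\<in>flow_set (Hh h) \<inter> S (p / 4). \<forall>w\<in>flow_map (Hh h) z.
      w \<in> {w. V w < p / 2}"
    by (rule eventually_flow_step_in[OF regular flow F S])
       (use p in \<open>auto simp: S_def intro!: open_Collect_less contV continuous_intros\<close>)
  have flow_W: "\<forall>\<^sub>F h in at_right 0. \<forall>z\<in>flow_set (Hh h) \<inter> K1. \<forall>w\<in>flow_map (Hh h) z.
      W w \<le> W z - h * \<kappa>"
  proof (rule eventually_flow_step_decreases[OF regular flow F K1 gW contgW])
    fix z assume "z \<in> ?C" "z \<in> K1"
    then show "gW z \<bullet> F z < - \<kappa>"
      using bspec[OF \<kappa>1(2), of z] by (simp add: gW_def \<kappa>_def inner_add_left)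
  qed
  have jump_Q: "\<forall>\<^sub>F h in at_right 0. \<forall>z\<in>jump_set (Hh h) \<inter> S (R + 2). \<forall>w\<in>jump_map (Hh h) z.
      (z, w) \<in> UNIV \<times> Q"
  proof (rule eventually_jump_step_in[OF regular bounded jump S])
    show "open (UNIV \<times> Q)" using openQ by (intro open_Times) auto
    fix z assume "z \<in> ?D" "z \<in> S (R + 2)"
    then show "(z, G z) \<in> UNIV \<times> Q"
      using jump_weak[of z] G(2)[of z] dist0[of "G z"] p by (auto simp: Q_def S_def)
  qed
  have jump_small: "\<forall>\<^sub>F h in at_right 0. \<forall>z\<in>jump_set (Hh h) \<inter> S (p / 4). \<forall>w\<in>jump_map (Hh h) z.
      (z, w) \<in> UNIV \<times> {w. V w < p / 2}"
  proof (rule eventually_jump_step_in[OF regular bounded jump S])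
    show "open (UNIV \<times> {w. V w < p / 2})"
      by (intro open_Times open_Collect_less contV continuous_intros) auto
    fix z assume "z \<in> ?D" "z \<in> S (p / 4)"
    then show "(z, G z) \<in> UNIV \<times> {w. V w < p / 2}"
      using jump_weak[of z] p by (auto simp: S_def)
  qed
  have jump_W: "\<forall>\<^sub>F h in at_right 0. \<forall>z\<in>jump_set (Hh h) \<inter> K1. \<forall>w\<in>jump_map (Hh h) z.
      (z, w) \<in> {x. W (snd x) < W (fst x) - \<kappa>}"
  proof (rule eventually_jump_step_in[OF regular bounded jump K1])
    show "open {x. W (snd x) < W (fst x) - \<kappa>}"
      by (intro open_Collect_less continuous_intros
          continuous_on_compose2[OF contW[of UNIV]]) auto
    fix z assume "z \<in> ?D" "z \<in> K1"
    then show "(z, G z) \<in> {x. W (snd x) < W (fst x) - \<kappa>}"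
      using bspec[OF \<kappa>2(2), of z] by (simp add: W_def \<kappa>_def algebra_simps)
  qed
  have start: "\<forall>\<^sub>F h in at_right 0. X h \<inter> {z. infdist z A \<le> r} \<subseteq> {z. infdist z ?C < p}"
    if "\<And>h :: nat \<Rightarrow> real. \<lbrakk>decseq h; \<forall>i. h i > 0; h \<longlonglongrightarrow> 0\<rbrakk> \<Longrightarrow> outer_limit (\<lambda>i. X (h i)) \<subseteq> ?C" for X
    by (rule eventually_subset_of_outer_limit[OF that Kr])
       (use dist0 p in \<open>auto intro!: open_Collect_less continuous_intros\<close>)
  have outer: "outer_limit (\<lambda>i. flow_set (Hh (h i))) \<subseteq> ?C" "outer_limit (\<lambda>i. jump_set (Hh (h i))) \<subseteq> ?D"
    if "decseq h" "\<forall>i. h i > 0" "h \<longlonglongrightarrow> 0" for h :: "nat \<Rightarrow> real"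
    using regular that by (simp_all add: regular_discretization_def)
  have start_flow: "\<forall>\<^sub>F h in at_right 0. flow_set (Hh h) \<inter> {z. infdist z A \<le> r} \<subseteq> {z. infdist z ?C < p}"
    by (rule start[OF outer(1)])
  have start_jump: "\<forall>\<^sub>F h in at_right 0. jump_set (Hh h) \<inter> {z. infdist z A \<le> r} \<subseteq> {z. infdist z ?C < p}"
    by (rule start[OF subset_trans[OF outer(2) sets(3)]])

  define good where "good h \<longleftrightarrow> (\<forall>E z. discrete_solution (Hh h) E z \<and> infdist (z (0, 0)) A \<le> r \<longrightarrow>
      (\<forall>(k, j) \<in> E. real k * h + real j \<ge> (R + 1) / \<kappa> \<longrightarrow> infdist (z (k, j)) A \<le> \<epsilon>))" for h
  have "\<forall>\<^sub>F h in at_right 0. good h"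
    using flow_Q flow_small flow_W jump_Q jump_small jump_W start_flow start_jump
      eventually_at_right_less[of 0]
  proof eventually_elim
    case (elim h)
    have flow_step: "w \<in> Q \<and> W w \<le> max (W z - h * \<kappa>) e"
      if z: "z \<in> S (R + 2)" "z \<in> flow_set (Hh h)" and w: "w \<in> flow_map (Hh h) z" for z w
    proof -
      have wQ: "w \<in> Q" using elim(1) z w by blast
      show ?thesis
      proof (cases "p / 4 \<le> V z")
        case True
        with z have "z \<in> K1" by (simp add: K1_def)
        with elim(3) z w wQ show ?thesis by fastforce
      next
        case False
        with z have "z \<in> S (p / 4)" by (simp add: S_def)
        with elim(2) z w have "V w < p / 2" by blast
        with WV[OF Q_K[OF wQ]] wQ show ?thesis by (simp add: e_def)
      qed
    qed
    have jump_step: "w \<in> Q \<and> W w \<le> max (W z - \<kappa>) e"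
      if z: "z \<in> S (R + 2)" "z \<in> jump_set (Hh h)" and w: "w \<in> jump_map (Hh h) z" for z w
    proof -
      have wQ: "w \<in> Q" using elim(4) z w by blast
      show ?thesis
      proof (cases "p / 4 \<le> V z")
        case True
        with z have "z \<in> K1" by (simp add: K1_def)
        with elim(6) z w wQ show ?thesis by fastforce
      next
        case False
        with z have "z \<in> S (p / 4)" by (simp add: S_def)
        with elim(5) z w have "V w < p / 2" by blast
        with WV[OF Q_K[OF wQ]] wQ show ?thesis by (simp add: e_def)
      qed
    qed
    have s_e: "s \<le> 1 / 8" "e + s \<le> 1" "0 < s" using p by (auto simp: e_def s_def)
    have "infdist (z (k, j)) A \<le> \<epsilon>"
      if sol: "discrete_solution (Hh h) E z" and z0: "infdist (z (0, 0)) A \<le> r"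
        and kj: "(k, j) \<in> E" and late: "real k * h + real j \<ge> (R + 1) / \<kappa>" for E z k j
    proof -
      define Inv where "Inv k j \<longleftrightarrow> z (k, j) \<in> Q \<and> z (k, j) \<in> S (R + 2) \<and>
        W (z (k, j)) \<le> max (R + 1 - \<kappa> * (real k * h + real j)) e" for k j
      have Inv: "Inv k j" if "z (k, j) \<in> Q"
        "W (z (k, j)) \<le> max (R + 1 - \<kappa> * (real k * h + real j)) e" for k j
      proof -
        have "\<kappa> * (real k * h + real j) \<ge> 0" using \<kappa> elim(9) by simp
        then have "V (z (k, j)) \<le> R + 2"
          using WV[OF Q_K[OF that(1)]] that(2) s_e R(1) by linarith
        with that p show ?thesis by (auto simp: Inv_def S_def Q_def)
      qed
      from sol kj have "Inv k j"
      proof (induction rule: discrete_solution_induct)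
        case init
        have "z (0, 0) \<in> flow_set (Hh h) \<union> jump_set (Hh h)"
          using sol by (simp add: discrete_solution_def)
        with elim(7,8) z0 have "infdist (z (0, 0)) ?C < p" by blast
        moreover have "V (z (0, 0)) \<le> R" using R(2) z0 .
        ultimately have Q0: "z (0, 0) \<in> Q" by (simp add: Q_def)
        then show ?case
          using WV[OF Q_K[OF Q0]] \<open>V (z (0, 0)) \<le> R\<close> s_e by (intro Inv) auto
      next
        case (flow k j)
        with flow_step[of "z (k, j)" "z (Suc k, j)"]
        have step: "z (Suc k, j) \<in> Q" "W (z (Suc k, j)) \<le> max (W (z (k, j)) - h * \<kappa>) e"
          by (auto simp: Inv_def)
        have "0 < h * \<kappa>" using \<kappa> elim(9) by simp
        moreover have "\<kappa> * (real (Suc k) * h + real j) = \<kappa> * (real k * h + real j) + h * \<kappa>"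
          by (simp add: algebra_simps)
        ultimately have "W (z (Suc k, j)) \<le> max (R + 1 - \<kappa> * (real (Suc k) * h + real j)) e"
          using step(2) flow(1) unfolding Inv_def by linarith
        with step(1) show ?case by (rule Inv)
      next
        case (jump k j)
        with jump_step[of "z (k, j)" "z (k, Suc j)"]
        have step: "z (k, Suc j) \<in> Q" "W (z (k, Suc j)) \<le> max (W (z (k, j)) - \<kappa>) e"
          by (auto simp: Inv_def)
        moreover have "\<kappa> * (real k * h + real (Suc j)) = \<kappa> * (real k * h + real j) + \<kappa>"
          by (simp add: algebra_simps)
        ultimately have "W (z (k, Suc j)) \<le> max (R + 1 - \<kappa> * (real k * h + real (Suc j))) e"
          using \<kappa> jump(1) unfolding Inv_def by linarith
        with step(1) show ?case by (rule Inv)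
      qed
      then have zQ: "z (k, j) \<in> Q" and W: "W (z (k, j)) \<le> max (R + 1 - \<kappa> * (real k * h + real j)) e"
        by (auto simp: Inv_def)
      have "\<kappa> * (real k * h + real j) \<ge> R + 1"
        using late \<kappa> by (simp add: pos_divide_le_eq mult.commute)
      with W have "W (z (k, j)) \<le> e" using p by (simp add: e_def s_def)
      then have "V (z (k, j)) \<le> p" using WV[OF Q_K[OF zQ]] p(1) unfolding e_def s_def by linarith
      with zQ show ?thesis by (intro p_eps) (auto simp: Q_def)
    qed
    then show ?case unfolding good_def by blast
  qed
  then obtain hs where hs: "hs > 0" "\<And>h. 0 < h \<Longrightarrow> h < hs \<Longrightarrow> good h"
    unfolding eventually_at_right_field by blast
  show ?thesis
  proof (rule exI[of _ hs], intro conjI ballI)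
    fix h assume h: "h \<in> {0<..<hs}"
    show "\<exists>T>0. \<forall>E z. discrete_solution (Hh h) E z \<and> infdist (z (0, 0)) A \<le> r \<longrightarrow>
        (\<forall>(k, j) \<in> E. real k * h + real j \<ge> T \<longrightarrow> infdist (z (k, j)) A \<le> \<epsilon>)"
      using hs(2)[of h] h R(1) \<kappa> unfolding good_def by (intro exI[of _ "(R + 1) / \<kappa>"]) auto
  qed (rule hs(1))
qed


section \<open>Gradients of convex functions\<close>

lemma GDERIV_unique:
  assumes "GDERIV f x :> g" "GDERIV f x :> g'"
  shows "g = g'"
proof -
  have "(\<lambda>h. h \<bullet> g) = (\<lambda>h. h \<bullet> g')"
    using assms unfolding gderiv_def by (rule has_derivative_unique)
  then show ?thesis by (metis vector_eq_ldot)
qed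

lemma differentiable_GDERIV_grad:
  fixes f :: "'a::euclidean_space \<Rightarrow> real"
  assumes "f differentiable (at x)"
  shows "GDERIV f x :> grad f x"
proof -
  obtain f' where f': "(f has_derivative f') (at x)"
    using assms by (auto simp: differentiable_def)
  then interpret linear f' by (rule has_derivative_linear)
  have "f' h = h \<bullet> (\<Sum>b\<in>Basis. f' b *\<^sub>R b)" for h
  proof -
    have "f' h = f' (\<Sum>b\<in>Basis. (h \<bullet> b) *\<^sub>R b)" by (simp add: euclidean_representation)
    also have "\<dots> = (\<Sum>b\<in>Basis. (h \<bullet> b) * f' b)" by (simp add: sum scale)
    also have "\<dots> = h \<bullet> (\<Sum>b\<in>Basis. f' b *\<^sub>R b)"
      by (simp add: inner_sum_right mult.commute)
    finally show ?thesis .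
  qed
  from has_derivative_eq_rhs[OF f' ext[OF this]]
  have g: "GDERIV f x :> (\<Sum>b\<in>Basis. f' b *\<^sub>R b)"
    unfolding gderiv_def .
  show ?thesis
    unfolding grad_def
    by (rule theI[of "\<lambda>g. GDERIV f x :> g", OF g]) (rule GDERIV_unique[OF _ g])
qed

lemma GDERIV_minimum_zero:
  assumes "GDERIV f x :> g" "\<And>y. f x \<le> f y"
  shows "g = 0"
proof -
  have "(\<lambda>h. h \<bullet> g) = (\<lambda>h. 0)"
    using assms by (intro differential_zero_maxmin[of x UNIV f]) (auto simp: gderiv_def)
  then show ?thesis by (metis inner_eq_zero_iff)
qed

lemma unique_minimizer_le:
  fixes f :: "'a \<Rightarrow> real"
  assumes "unique_minimizer f xs"
  shows "f xs \<le> f x"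
  using assms unfolding unique_minimizer_def is_arg_min_def by (metis linorder_not_less)

lemma unique_minimizer_eq:
  fixes f :: "'a \<Rightarrow> real"
  assumes "unique_minimizer f xs" "f x = f xs"
  shows "x = xs"
  using assms unique_minimizer_le[OF assms(1)]
  unfolding unique_minimizer_def is_arg_min_def by (metis linorder_not_less)

text \<open>Restriction to the line through \<open>x\<close> and \<open>y\<close> reduces this to the one-dimensional
  inequality.\<close>

lemma convex_on_above_tangent_GDERIV:
  fixes f :: "'a::real_inner \<Rightarrow> real"
  assumes convex: "convex_on UNIV f" and "GDERIV f x :> g"
  shows "f x + g \<bullet> (y - x) \<le> f y"
proof -
  define \<phi> where "\<phi> t = f (x + t *\<^sub>R (y - x))" for t
  have "convex_on UNIV \<phi>"
    unfolding convex_on_alt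
  proof (intro conjI ballI allI impI)
    fix s t u :: real assume u: "0 \<le> u \<and> u \<le> 1"
    have "x + (u *\<^sub>R s + (1 - u) *\<^sub>R t) *\<^sub>R (y - x)
        = u *\<^sub>R (x + s *\<^sub>R (y - x)) + (1 - u) *\<^sub>R (x + t *\<^sub>R (y - x))"
      by (simp add: algebra_simps)
    with convex u show "\<phi> (u *\<^sub>R s + (1 - u) *\<^sub>R t) \<le> u * \<phi> s + (1 - u) * \<phi> t"
      unfolding convex_on_alt \<phi>_def by simp
  qed simp
  moreover have "(\<phi> has_field_derivative g \<bullet> (y - x)) (at 0 within UNIV)"
    unfolding \<phi>_def using assms(2) by (intro GDERIV_along_line) simp
  ultimately have "g \<bullet> (y - x) * (1 - 0) \<le> \<phi> 1 - \<phi> 0"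
    by (intro convex_on_imp_above_tangent[of UNIV]) auto
  then show ?thesis by (simp add: \<phi>_def)
qed

text \<open>If the tangent at \<open>x\<close> meets the graph over the minimizer, convexity makes \<open>f\<close> affine on the
  segment from \<open>xs\<close> to \<open>x\<close>. Its slope there is the one at \<open>xs\<close>, which is \<open>0\<close>. This is where
  continuity of the gradient replaces strict convexity.\<close>

lemma convex_tangent_through_minimum:
  fixes f :: "'a::real_inner \<Rightarrow> real"
  assumes convex: "convex_on UNIV f"
    and g: "\<And>x. GDERIV f x :> g x" "continuous_on UNIV g"
    and min: "\<And>y. f xs \<le> f y"
    and tangent: "g x \<bullet> (x - xs) \<le> f x - f xs"
  shows "f x = f xs"
proof -
  have above: "f u + g u \<bullet> (v - u) \<le> f v" for u v
    using convex_on_above_tangent_GDERIV[OF convex g(1)] .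
  have g0: "g xs = 0" using GDERIV_minimum_zero[OF g(1) min] .
  \<comment> \<open>The point \<open>xs + t (x - xs)\<close> lies above the tangent at \<open>x\<close>, and \<open>xs\<close> lies above the tangent
    at that point.\<close>
  have chord: "f x - f xs \<le> g (xs + t *\<^sub>R (x - xs)) \<bullet> (x - xs)" if "t > 0" for t
  proof -
    define y where "y = xs + t *\<^sub>R (x - xs)"
    have "y - x = (t - 1) *\<^sub>R (x - xs)" "xs - y = (- t) *\<^sub>R (x - xs)" "xs - x = - (x - xs)"
      by (simp_all add: y_def algebra_simps)
    then have "f x + (t - 1) * (g x \<bullet> (x - xs)) \<le> f y" "f y - t * (g y \<bullet> (x - xs)) \<le> f xs"
      "f x - g x \<bullet> (x - xs) \<le> f xs"
      using above[of x y] above[of y xs] above[of x xs]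
      by (simp_all only: inner_scaleR_right inner_minus_right mult_minus_left)
    moreover from this(3) tangent have "g x \<bullet> (x - xs) = f x - f xs" by simp
    ultimately have "t * (f x - f xs) \<le> t * (g y \<bullet> (x - xs))"
      by (simp add: left_diff_distrib)
    with that show ?thesis by (simp add: y_def)
  qed
  have "((\<lambda>t. g (xs + t *\<^sub>R (x - xs)) \<bullet> (x - xs)) \<longlongrightarrow> 0) (at_right 0)"
  proof -
    have "((\<lambda>t. xs + t *\<^sub>R (x - xs)) \<longlongrightarrow> xs) (at_right 0)"
      by (auto intro!: tendsto_eq_intros)
    from continuous_on_tendsto_compose[OF g(2) this] g0
    have "((\<lambda>t. g (xs + t *\<^sub>R (x - xs))) \<longlongrightarrow> 0) (at_right 0)" by simp
    from tendsto_inner[OF this tendsto_const] show ?thesis by simp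
  qed
  then have "f x - f xs \<le> 0"
    by (rule tendsto_lowerbound)
       (use chord in \<open>auto simp: eventually_at_right_field intro!: exI[of _ 1]\<close>)
  with min[of x] show ?thesis by simp
qed


section \<open>Energy and auxiliary function of the HAND systems\<close>

definition HAND_energy :: "('a::real_inner \<Rightarrow> real) \<Rightarrow> real \<Rightarrow> 'a \<Rightarrow> 'a \<times> 'a \<times> real \<Rightarrow> real" where
  "HAND_energy f c xs = (\<lambda>(x1, x2, \<tau>).
     (x2 - xs) \<bullet> (x2 - xs) / 2 + c * \<tau>\<^sup>2 * (f x1 - f xs))"

text \<open>At \<open>x1 = xs\<close> the flow has \<open>x1' = (2 / \<tau>) (x2 - xs)\<close> and \<open>x2' = 0\<close>, so the mixed term decreases
  at rate \<open>(2 / \<tau>) \<bar>x2 - xs\<bar>\<^sup>2\<close>. The first term grows at rate \<open>\<gamma> \<bar>x2 - xs\<bar>\<^sup>2\<close>, which is slower for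
  \<open>\<gamma> = 1 / Tmax\<close>; it is there for the timer resets of HAND-1, which leave the mixed term
  unchanged.\<close>

definition HAND_auxiliary :: "real \<Rightarrow> 'a::real_inner \<Rightarrow> 'a \<times> 'a \<times> real \<Rightarrow> real" where
  "HAND_auxiliary \<gamma> xs = (\<lambda>(x1, x2, \<tau>).
     \<gamma> * \<tau> * ((x2 - xs) \<bullet> (x2 - xs)) - (x1 - xs) \<bullet> (x2 - xs))"

lemma HAND_energy_GDERIV:
  assumes "GDERIV f (fst z) :> g"
  shows "GDERIV (HAND_energy f c xs) z :>
    ((c * (snd (snd z))\<^sup>2) *\<^sub>R g, fst (snd z) - xs, 2 * c * snd (snd z) * (f (fst z) - f xs))"
proof -
  note f = has_derivative_compose[OF has_derivative_fst[OF has_derivative_ident] assms[unfolded gderiv_def]]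
  have sq: "((\<lambda>z. (fst (snd z) - xs) \<bullet> (fst (snd z) - xs) / 2) has_derivative
      (\<lambda>h. fst (snd h) \<bullet> (fst (snd z) - xs))) (at z)"
    by (rule has_derivative_eq_rhs, (rule derivative_intros refl)+)
       (auto simp: fun_eq_iff inner_commute)
  have \<tau>: "((\<lambda>z. c * (snd (snd z))\<^sup>2) has_derivative (\<lambda>h. 2 * c * snd (snd z) * snd (snd h))) (at z)"
    by (rule has_derivative_eq_rhs, (rule derivative_intros refl)+) (auto simp: fun_eq_iff)
  show ?thesis
    unfolding gderiv_def HAND_energy_def case_prod_unfold
    by (rule has_derivative_eq_rhs[OF has_derivative_add[OF sq
          has_derivative_mult[OF \<tau> has_derivative_diff[OF f has_derivative_const]]]])
       (auto simp: fun_eq_iff inner_prod_def algebra_simps)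
qed

lemma HAND_auxiliary_GDERIV:
  "GDERIV (HAND_auxiliary \<gamma> xs) z :>
    (- (fst (snd z) - xs),
     (2 * \<gamma> * snd (snd z)) *\<^sub>R (fst (snd z) - xs) - (fst z - xs),
     \<gamma> * ((fst (snd z) - xs) \<bullet> (fst (snd z) - xs)))"
  unfolding gderiv_def HAND_auxiliary_def case_prod_unfold
  by (rule has_derivative_eq_rhs, (rule derivative_intros refl)+)
     (auto simp: fun_eq_iff inner_prod_def algebra_simps inner_commute)

lemma HAND_flow_set_thickening:
  assumes "infdist (x1, x2, \<tau>) {(x1 :: 'a::euclidean_space, x2 :: 'a, \<tau>). \<tau> \<in> {Tmin..Tmax}} \<le> \<sigma>"
    and "Tmin \<le> Tmax"
  shows "\<tau> \<in> {Tmin - \<sigma>..Tmax + \<sigma>}"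
proof -
  have eq: "{(x1 :: 'a, x2 :: 'a, \<tau>). \<tau> \<in> {Tmin..Tmax}} = UNIV \<times> UNIV \<times> {Tmin..Tmax}" by auto
  have "closed (UNIV \<times> UNIV \<times> {Tmin..Tmax} :: ('a \<times> 'a \<times> real) set)"
    by (intro closed_Times closed_UNIV closed_atLeastAtMost)
  moreover have "(UNIV \<times> UNIV \<times> {Tmin..Tmax} :: ('a \<times> 'a \<times> real) set) \<noteq> {}"
    using assms(2) by auto
  ultimately obtain y where y: "y \<in> (UNIV \<times> UNIV \<times> {Tmin..Tmax} :: ('a \<times> 'a \<times> real) set)"
    "infdist (x1, x2, \<tau>) (UNIV \<times> UNIV \<times> {Tmin..Tmax}) = dist (x1, x2, \<tau>) y"
    by (rule infdist_attains_inf)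
  have "dist \<tau> (snd (snd y)) \<le> dist (x1, x2, \<tau>) y"
    using dist_snd_le[of "(x1, x2, \<tau>)" y] dist_snd_le[of "(x2, \<tau>)" "snd y"] by simp
  with y assms(1) show ?thesis
    unfolding eq by (auto simp: dist_real_def)
qed

text \<open>The thickness \<open>Tmin / 2\<close> keeps \<open>\<tau>\<close> away from \<open>0\<close>, so that the energy controls \<open>f x1\<close> and,
  by radial unboundedness, \<open>x1\<close>.\<close>

lemma HAND_energy_sublevel_compact:
  fixes f :: "'a::euclidean_space \<Rightarrow> real"
  assumes cont: "continuous_on UNIV f" and unbounded: "radially_unbounded f"
    and min: "\<And>x. f xs \<le> f x"
    and c: "c > 0" and T: "0 < Tmin" "Tmin \<le> Tmax"
  shows "compact {z. infdist z {(x1, x2, \<tau>). \<tau> \<in> {Tmin..Tmax}} \<le> Tmin / 2 \<and>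
    HAND_energy f c xs z \<le> v}" (is "compact ?X")
proof -
  define L where "L = v / (c * (Tmin / 2)\<^sup>2)"
  have "bounded {x. f x \<le> f xs + L}"
  proof -
    have "\<forall>\<^sub>F x in at_infinity. f x > f xs + L"
      using unbounded unfolding radially_unbounded_def by (simp add: filterlim_at_top_dense)
    then obtain b where b: "\<And>x. b \<le> norm x \<Longrightarrow> f x > f xs + L"
      by (auto simp: eventually_at_infinity)
    have "norm x \<le> b" if "f x \<le> f xs + L" for x
      using b[of x] that by linarith
    then show ?thesis by (auto simp: bounded_iff)
  qed
  then have "bounded ({x. f x \<le> f xs + L} \<times> cball xs (sqrt (2 * v)) \<times> {Tmin - Tmin / 2..Tmax + Tmin / 2})"
    by (intro bounded_Times bounded_cball) auto
  moreover have "?X \<subseteq> {x. f x \<le> f xs + L} \<times> cball xs (sqrt (2 * v)) \<times> {Tmin - Tmin / 2..Tmax + Tmin / 2}"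
  proof clarify
    fix x1 x2 :: 'a and \<tau> :: real
    assume "infdist (x1, x2, \<tau>) {(x1, x2, \<tau>). \<tau> \<in> {Tmin..Tmax}} \<le> Tmin / 2"
      and V: "HAND_energy f c xs (x1, x2, \<tau>) \<le> v"
    then have \<tau>: "\<tau> \<in> {Tmin - Tmin / 2..Tmax + Tmin / 2}"
      using T by (intro HAND_flow_set_thickening)
    have pos: "0 \<le> (x2 - xs) \<bullet> (x2 - xs)" "0 \<le> f x1 - f xs" using min by simp_all
    have "c * (Tmin / 2)\<^sup>2 \<le> c * \<tau>\<^sup>2"
      using \<tau> T c by (intro mult_left_mono power_mono) auto
    then have le: "c * (Tmin / 2)\<^sup>2 * (f x1 - f xs) \<le> c * \<tau>\<^sup>2 * (f x1 - f xs)"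
      using pos by (intro mult_right_mono)
    moreover have "0 \<le> c * (Tmin / 2)\<^sup>2 * (f x1 - f xs)"
      using c pos by simp
    moreover have "(x2 - xs) \<bullet> (x2 - xs) / 2 + c * \<tau>\<^sup>2 * (f x1 - f xs) \<le> v"
      using V by (simp add: HAND_energy_def)
    ultimately have "(x2 - xs) \<bullet> (x2 - xs) \<le> 2 * v" "c * (Tmin / 2)\<^sup>2 * (f x1 - f xs) \<le> v"
      using pos by linarith+
    moreover have "c * (Tmin / 2)\<^sup>2 > 0" using c T by simp
    ultimately have "f x1 - f xs \<le> L" "norm (x2 - xs) \<le> sqrt (2 * v)"
      unfolding L_def by (simp_all add: pos_le_divide_eq mult.commute norm_eq_sqrt_inner)
    with \<tau> show "x1 \<in> {x. f x \<le> f xs + L} \<and> (x2, \<tau>) \<in> cball xs (sqrt (2 * v)) \<times> {Tmin - Tmin / 2..Tmax + Tmin / 2}"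
      by (auto simp: dist_norm norm_minus_commute)
  qed
  ultimately have "bounded ?X" by (rule bounded_subset)
  moreover have "continuous_on UNIV (HAND_energy f c xs)"
    unfolding HAND_energy_def case_prod_unfold
    by (intro continuous_intros continuous_on_compose2[OF cont]) auto
  then have "closed ?X"
    by (intro closed_Collect_conj closed_Collect_le continuous_intros)
  ultimately show ?thesis by (simp add: compact_eq_bounded_closed)
qed


section \<open>The two HAND systems\<close>

text \<open>The two systems share the flow; they enter only through their jumps, which must not raise the
  energy and must lower the auxiliary function wherever they preserve the energy off the
  attractor.\<close>

lemma HAND_practical_stability:
  fixes f :: "'a::euclidean_space \<Rightarrow> real"
    and H :: "('a \<times> 'a \<times> real) hybrid_system"
  assumes C2: "twice_continuously_differentiable f"
    and convex: "convex_on UNIV f"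
    and unbounded: "radially_unbounded f"
    and minimizer: "unique_minimizer f xs"
    and c: "c > 0" and T: "0 < Tmin" "Tmin < Tmax"
    and flow: "flow_map H = (\<lambda>z. {HAND_flow f c z})"
      "flow_set H = {(x1, x2, \<tau>). \<tau> \<in> {Tmin..Tmax}}"
    and jump: "jump_map H = (\<lambda>z. {G z})" "continuous_on UNIV G"
      "\<And>z. z \<in> jump_set H \<Longrightarrow> G z \<in> flow_set H"
      "closed (jump_set H)" "jump_set H \<subseteq> flow_set H"
    and jump_weak: "\<And>z. z \<in> jump_set H \<Longrightarrow> HAND_energy f c xs (G z) \<le> HAND_energy f c xs z"
    and jump_aux: "\<And>x1 x2 \<tau>. \<lbrakk>(x1, x2, \<tau>) \<in> jump_set H; x1 \<noteq> xs \<or> x2 \<noteq> xs;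
        HAND_energy f c xs (G (x1, x2, \<tau>)) = HAND_energy f c xs (x1, x2, \<tau>)\<rbrakk>
      \<Longrightarrow> HAND_auxiliary (1 / Tmax) xs (G (x1, x2, \<tau>)) < HAND_auxiliary (1 / Tmax) xs (x1, x2, \<tau>)"
    and regular: "regular_discretization H Hh"
    and bounded: "jumps_locally_eventually_bounded Hh"
    and A: "A = {xs} \<times> {xs} \<times> {Tmin..Tmax}"
    and r: "r > 0" and \<epsilon>: "\<epsilon> > 0"
  shows "\<exists>hs>0. \<forall>h\<in>{0<..<hs}. \<exists>T>0. \<forall>E z.
           discrete_solution (Hh h) E z \<and> infdist (z (0, 0)) A \<le> r \<longrightarrow>
           (\<forall>(k, j) \<in> E. real k * h + real j \<ge> T \<longrightarrow> infdist (z (k, j)) A \<le> \<epsilon>)"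
proof -
  let ?g = "grad f" and ?V = "HAND_energy f c xs" and ?U = "HAND_auxiliary (1 / Tmax) xs"
  have g: "GDERIV f x :> ?g x" for x
    using C2 unfolding twice_continuously_differentiable_def
    by (intro differentiable_GDERIV_grad) blast
  have contg: "continuous_on UNIV ?g"
    using C2 unfolding twice_continuously_differentiable_def
    by (blast intro: continuous_at_imp_continuous_on has_derivative_continuous)
  have contf: "continuous_on UNIV f"
    using g unfolding gderiv_def
    by (blast intro: continuous_at_imp_continuous_on has_derivative_continuous)
  note min = unique_minimizer_le[OF minimizer]
  note min_unique = unique_minimizer_eq[OF minimizer]
  have g0: "?g xs = 0" using GDERIV_minimum_zero[OF g min] .
  have tangent: "f x - f xs \<le> ?g x \<bullet> (x - xs)" for x
    using convex_on_above_tangent_GDERIV[OF convex g, of x xs] by (simp add: inner_diff_right)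
  have C_eq: "flow_set H = UNIV \<times> UNIV \<times> {Tmin..Tmax}" using flow(2) by auto

  define gV where "gV z = ((c * (snd (snd z))\<^sup>2) *\<^sub>R ?g (fst z), fst (snd z) - xs,
      2 * c * snd (snd z) * (f (fst z) - f xs))" for z :: "'a \<times> 'a \<times> real"
  define gU where "gU z = (- (fst (snd z) - xs),
      (2 * (1 / Tmax) * snd (snd z)) *\<^sub>R (fst (snd z) - xs) - (fst z - xs),
      1 / Tmax * ((fst (snd z) - xs) \<bullet> (fst (snd z) - xs)))" for z :: "'a \<times> 'a \<times> real"
  have dV: "GDERIV ?V z :> gV z" for z unfolding gV_def by (rule HAND_energy_GDERIV[OF g])
  have dU: "GDERIV ?U z :> gU z" for z unfolding gU_def by (rule HAND_auxiliary_GDERIV)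
  have flow_V: "gV (x1, x2, \<tau>) \<bullet> HAND_flow f c (x1, x2, \<tau>)
      = 2 * c * \<tau> * ((f x1 - f xs) - ?g x1 \<bullet> (x1 - xs))" if "\<tau> > 0" for x1 x2 \<tau>
  proof -
    have "gV (x1, x2, \<tau>) \<bullet> HAND_flow f c (x1, x2, \<tau>) = c * \<tau>\<^sup>2 * (2 / \<tau>) * (?g x1 \<bullet> (x2 - x1))
        - 2 * c * \<tau> * (?g x1 \<bullet> (x2 - xs)) + 2 * c * \<tau> * (f x1 - f xs)"
      by (simp add: gV_def HAND_flow_def inner_prod_def inner_commute)
    also have "c * \<tau>\<^sup>2 * (2 / \<tau>) = 2 * c * \<tau>" using that by (simp add: power2_eq_square)
    finally show ?thesis by (simp add: inner_diff_right algebra_simps)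
  qed

  show ?thesis
  proof (rule practical_stability_of_regular_discretization
      [OF regular bounded flow(1) jump(1) _ jump(4,5) _ jump(2,3) dV _ dU _ _ _ _ _ _ _ _ jump_weak _ r \<epsilon>])
    show "closed (flow_set H)"
      unfolding C_eq by (intro closed_Times closed_UNIV closed_atLeastAtMost)
    show "isCont (HAND_flow f c) z" if "z \<in> flow_set H" for z
    proof -
      have "snd (snd z) \<noteq> 0" using that T by (auto simp: C_eq)
      moreover have "isCont (\<lambda>z. ?g (fst z)) z"
        using contg by (intro isCont_o2[OF _ continuous_on_interior[OF contg]] continuous_intros) auto
      ultimately show ?thesis
        unfolding HAND_flow_def case_prod_unfold by (intro continuous_intros)
    qed
    show "continuous_on UNIV gV" unfolding gV_def
      by (intro continuous_intros continuous_on_compose2[OF contf] continuous_on_compose2[OF contg]) auto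
    show "continuous_on UNIV gU" unfolding gU_def by (intro continuous_intros)
    show V_nonneg: "0 \<le> ?V z" for z
      using c min[of "fst z"] by (simp add: HAND_energy_def case_prod_unfold)
    show "A = {z \<in> flow_set H. ?V z = 0}"
    proof -
      have "?V (x1, x2, \<tau>) = 0 \<longleftrightarrow> x1 = xs \<and> x2 = xs" if "\<tau> \<in> {Tmin..Tmax}" for x1 x2 \<tau>
      proof -
        have "c * \<tau>\<^sup>2 > 0" using that c T by simp
        moreover have "0 \<le> c * \<tau>\<^sup>2 * (f x1 - f xs)" using c min[of x1] by simp
        moreover have "0 \<le> (x2 - xs) \<bullet> (x2 - xs)" by simp
        ultimately have "?V (x1, x2, \<tau>) = 0 \<longleftrightarrow> (x2 - xs) \<bullet> (x2 - xs) = 0 \<and> f x1 - f xs = 0"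
          unfolding HAND_energy_def case_prod_conv by (smt (verit) divide_eq_0_iff mult_eq_0_iff field_sum_of_halves)
        also have "\<dots> \<longleftrightarrow> x1 = xs \<and> x2 = xs" using min_unique[of x1] by auto
        finally show ?thesis .
      qed
      then show ?thesis by (auto simp: A C_eq)
    qed
    show "A \<noteq> {}" using T by (simp add: A)
    show "0 < Tmin / 2" using T by simp
    show "compact {z. infdist z (flow_set H) \<le> Tmin / 2 \<and> ?V z \<le> v}" for v
      unfolding flow(2) using T c min
      by (intro HAND_energy_sublevel_compact contf unbounded) auto
    show "gV z \<bullet> HAND_flow f c z \<le> 0" if "z \<in> flow_set H" for z
    proof -
      obtain x1 x2 \<tau> where z: "z = (x1, x2, \<tau>)" by (cases z) auto
      with that T have "\<tau> > 0" by (simp add: C_eq)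
      then show ?thesis
        unfolding z flow_V[OF \<open>\<tau> > 0\<close>] using c tangent[of x1] by (intro mult_nonneg_nonpos) auto
    qed
    show "gU z \<bullet> HAND_flow f c z < 0"
      if zC: "z \<in> flow_set H" and zA: "z \<notin> A" and eq: "gV z \<bullet> HAND_flow f c z = 0" for z
    proof -
      obtain x1 x2 \<tau> where z: "z = (x1, x2, \<tau>)" by (cases z) auto
      with zC T have \<tau>: "\<tau> > 0" "\<tau> \<le> Tmax" "\<tau> \<in> {Tmin..Tmax}" by (simp_all add: C_eq)
      have "?g x1 \<bullet> (x1 - xs) \<le> f x1 - f xs"
        using eq c \<tau>(1) unfolding z flow_V[OF \<tau>(1)] by simp
      from min_unique[OF convex_tangent_through_minimum[OF convex g contg min this]]
      have x1: "x1 = xs" .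
      with zA \<tau> z have "x2 \<noteq> xs" by (auto simp: A)
      then have pos: "(x2 - xs) \<bullet> (x2 - xs) > 0" by simp
      have "gU z \<bullet> HAND_flow f c z = (1 / Tmax - 2 / \<tau>) * ((x2 - xs) \<bullet> (x2 - xs))"
        using inner_minus_left[of "x2 - xs" "x2 - xs"]
        by (simp add: z x1 gU_def HAND_flow_def inner_prod_def g0 left_diff_distrib)
      moreover have "1 / Tmax < 2 / \<tau>" using \<tau> by (simp add: frac_less2 divide_simps)
      ultimately show ?thesis using pos by (simp add: mult_neg_pos)
    qed
    show "?U (G z) < ?U z"
      if "z \<in> jump_set H" "z \<notin> A" "?V (G z) = ?V z" for z
    proof -
      obtain x1 x2 \<tau> where z: "z = (x1, x2, \<tau>)" by (cases z) auto
      with that jump(5) have "x1 \<noteq> xs \<or> x2 \<noteq> xs" by (auto simp: A C_eq)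
      with that jump_aux show ?thesis by (simp add: z)
    qed
  qed
qed

theorem mainTheorem3:
  fixes f :: "real ^ 'n \<Rightarrow> real" and xs :: "real ^ 'n"
    and c \<mu> Tmin Tmed Tmax r \<epsilon> :: real
    and H :: "((real ^ 'n) \<times> (real ^ 'n) \<times> real) hybrid_system"
    and Hh :: "real \<Rightarrow> ((real ^ 'n) \<times> (real ^ 'n) \<times> real) hybrid_system"
    and A :: "((real ^ 'n) \<times> (real ^ 'n) \<times> real) set"
  assumes C2: "twice_continuously_differentiable f"
    and convex: "convex_on UNIV f"
    and unbounded: "radially_unbounded f"
    and minimizer: "unique_minimizer f xs"
    and c: "c > 0"
    and system:
      "(H = HAND1 f c Tmin Tmed Tmax \<and> 0 < Tmin \<and> Tmin < Tmed \<and> Tmed \<le> Tmax) \<or>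
       (H = HAND2 f c Tmin Tmax \<and> 0 < Tmin \<and> Tmin < Tmax \<and>
        \<mu> > 0 \<and> strongly_convex \<mu> f \<and> (\<exists>L. L-lipschitz_on UNIV (grad f)) \<and>
        Tmax\<^sup>2 - Tmin\<^sup>2 > 1 / (\<mu> * c))"
    and A: "A = {xs} \<times> {xs} \<times> {Tmin..Tmax}"
    and regular: "regular_discretization H Hh"
    and jumps_bounded: "jumps_locally_eventually_bounded Hh"
    and radii: "r > \<epsilon>" "\<epsilon> > 0"
  shows "\<exists>hs>0. \<forall>h\<in>{0<..<hs}. \<exists>T>0. \<forall>E z.
           discrete_solution (Hh h) E z \<and> infdist (z (0, 0)) A \<le> r \<longrightarrow>
           (\<forall>(k, j) \<in> E. real k * h + real j \<ge> T \<longrightarrow> infdist (z (k, j)) A \<le> \<epsilon>)"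
proof -
  have r: "r > 0" using radii by simp
  note min = unique_minimizer_le[OF minimizer]
  note min_unique = unique_minimizer_eq[OF minimizer]
  from system show ?thesis
  proof (elim disjE conjE)
    assume H: "H = HAND1 f c Tmin Tmed Tmax" and T: "0 < Tmin" "Tmin < Tmed" "Tmed \<le> Tmax"
    let ?G = "\<lambda>z :: (real ^ 'n) \<times> (real ^ 'n) \<times> real. (fst z, fst (snd z), Tmin)"
    have D: "jump_set H = UNIV \<times> UNIV \<times> {Tmed..Tmax}" by (auto simp: H HAND1_def)
    have energy: "HAND_energy f c xs (?G (x1, x2, \<tau>))
        = HAND_energy f c xs (x1, x2, \<tau>) - c * (\<tau>\<^sup>2 - Tmin\<^sup>2) * (f x1 - f xs)" for x1 x2 \<tau>
      by (simp add: HAND_energy_def algebra_simps)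
    have gain: "c * (\<tau>\<^sup>2 - Tmin\<^sup>2) > 0" if "\<tau> \<ge> Tmed" for \<tau>
      using that T c by (simp add: power_strict_mono)
    show ?thesis
    proof (rule HAND_practical_stability[OF C2 convex unbounded minimizer c _ _ _ _ _ _ _ _ _ _ _
          regular jumps_bounded A r radii(2)])
      show "0 < Tmin" "Tmin < Tmax" using T by simp_all
      show "flow_map H = (\<lambda>z. {HAND_flow f c z})"
        "flow_set H = {(x1, x2, \<tau>). \<tau> \<in> {Tmin..Tmax}}"
        "jump_map H = (\<lambda>z. {?G z})"
        by (auto simp: H HAND1_def)
      show "continuous_on UNIV ?G" by (intro continuous_intros)
      show "?G z \<in> flow_set H" if "z \<in> jump_set H" for z
        using T by (simp add: H HAND1_def)
      show "closed (jump_set H)"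
        unfolding D by (intro closed_Times closed_UNIV closed_atLeastAtMost)
      show "jump_set H \<subseteq> flow_set H" using T by (auto simp: H HAND1_def)
      show "HAND_energy f c xs (?G z) \<le> HAND_energy f c xs z" if "z \<in> jump_set H" for z
      proof -
        obtain x1 x2 \<tau> where z: "z = (x1, x2, \<tau>)" by (cases z) auto
        with that gain[of \<tau>] min[of x1] show ?thesis
          unfolding z energy by (simp add: D)
      qed
      show "HAND_auxiliary (1 / Tmax) xs (?G (x1, x2, \<tau>)) < HAND_auxiliary (1 / Tmax) xs (x1, x2, \<tau>)"
        if "(x1, x2, \<tau>) \<in> jump_set H" "x1 \<noteq> xs \<or> x2 \<noteq> xs"
          "HAND_energy f c xs (?G (x1, x2, \<tau>)) = HAND_energy f c xs (x1, x2, \<tau>)" for x1 x2 \<tau>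
      proof -
        have \<tau>: "Tmed \<le> \<tau>" using that by (simp add: D)
        from that(3) have "c * (\<tau>\<^sup>2 - Tmin\<^sup>2) * (f x1 - f xs) = 0" unfolding energy by linarith
        with gain[OF \<tau>] have "f x1 = f xs" by (metis less_irrefl mult_eq_0_iff right_minus_eq)
        with min_unique that(2) have x: "x1 = xs" "x2 \<noteq> xs" by auto
        then have "(x2 - xs) \<bullet> (x2 - xs) > 0" by simp
        moreover have "1 / Tmax * Tmin < 1 / Tmax * \<tau>" using T \<tau> by (intro mult_strict_left_mono) auto
        ultimately have "1 / Tmax * Tmin * ((x2 - xs) \<bullet> (x2 - xs)) < 1 / Tmax * \<tau> * ((x2 - xs) \<bullet> (x2 - xs))"
          by (intro mult_strict_right_mono)
        then show ?thesis by (simp add: HAND_auxiliary_def x(1))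
      qed
    qed
  next
    assume H: "H = HAND2 f c Tmin Tmax" and T: "0 < Tmin" "Tmin < Tmax"
      and \<mu>: "\<mu> > 0" "strongly_convex \<mu> f" and gap: "Tmax\<^sup>2 - Tmin\<^sup>2 > 1 / (\<mu> * c)"
    let ?G = "\<lambda>z :: (real ^ 'n) \<times> (real ^ 'n) \<times> real. (fst z, fst z, Tmin)"
    have D: "jump_set H = UNIV \<times> UNIV \<times> {Tmax}" by (auto simp: H HAND2_def)
    have "GDERIV f xs :> grad f xs"
      using C2 unfolding twice_continuously_differentiable_def
      by (intro differentiable_GDERIV_grad) blast
    then have g0: "grad f xs = 0" using min by (rule GDERIV_minimum_zero)
    have growth: "\<mu> / 2 * ((x - xs) \<bullet> (x - xs)) \<le> f x - f xs" for x
      using \<mu>(2)[unfolded strongly_convex_def, rule_format, of xs x] g0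
      by (simp add: dot_square_norm)
    \<comment> \<open>Strong convexity turns the loss of potential energy into at least \<open>(1 + \<beta>) / 2\<close> times
      \<open>\<bar>x1 - xs\<bar>\<^sup>2\<close>, of which the new momentum \<open>x1 - xs\<close> uses up \<open>1 / 2\<close>.\<close>
    define \<beta> where "\<beta> = \<mu> * c * (Tmax\<^sup>2 - Tmin\<^sup>2) - 1"
    have \<beta>: "\<beta> > 0" using gap \<mu>(1) c by (simp add: \<beta>_def pos_divide_less_eq mult.commute)
    define \<delta> where "\<delta> x1 x2 = (\<beta> * ((x1 - xs) \<bullet> (x1 - xs)) + (x2 - xs) \<bullet> (x2 - xs)) / 2" for x1 x2
    have \<delta>: "0 \<le> \<delta> x1 x2" for x1 x2
      using \<beta> by (simp add: \<delta>_def)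
    have \<delta>_pos: "0 < \<delta> x1 x2" if "x1 \<noteq> xs \<or> x2 \<noteq> xs" for x1 x2
      using \<beta> that by (auto simp: \<delta>_def intro: add_pos_nonneg add_nonneg_pos)
    have energy: "HAND_energy f c xs (x1, x1, Tmin) \<le> HAND_energy f c xs (x1, x2, Tmax)
        - \<delta> x1 x2" for x1 x2
    proof -
      have "Tmin\<^sup>2 < Tmax\<^sup>2" using T by (intro power_strict_mono) auto
      then have "c * (Tmax\<^sup>2 - Tmin\<^sup>2) * (\<mu> / 2 * ((x1 - xs) \<bullet> (x1 - xs)))
          \<le> c * (Tmax\<^sup>2 - Tmin\<^sup>2) * (f x1 - f xs)"
        using c growth by (intro mult_left_mono) auto
      moreover have "c * (Tmax\<^sup>2 - Tmin\<^sup>2) * (\<mu> / 2 * ((x1 - xs) \<bullet> (x1 - xs)))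
          = (\<beta> + 1) * ((x1 - xs) \<bullet> (x1 - xs)) / 2"
        by (simp add: \<beta>_def)
      moreover have "HAND_energy f c xs (x1, x1, Tmin) = HAND_energy f c xs (x1, x2, Tmax)
          + ((x1 - xs) \<bullet> (x1 - xs) - (x2 - xs) \<bullet> (x2 - xs)) / 2
          - c * (Tmax\<^sup>2 - Tmin\<^sup>2) * (f x1 - f xs)"
        unfolding HAND_energy_def case_prod_conv
        by (simp only: left_diff_distrib right_diff_distrib diff_divide_distrib)
      ultimately show ?thesis
        by (simp only: \<delta>_def distrib_right add_divide_distrib diff_divide_distrib mult_1)
    qed
    show ?thesis
    proof (rule HAND_practical_stability[OF C2 convex unbounded minimizer c T _ _ _ _ _ _ _ _ _
          regular jumps_bounded A r radii(2)])
      show "flow_map H = (\<lambda>z. {HAND_flow f c z})"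
        "flow_set H = {(x1, x2, \<tau>). \<tau> \<in> {Tmin..Tmax}}"
        "jump_map H = (\<lambda>z. {?G z})"
        by (auto simp: H HAND2_def)
      show "continuous_on UNIV ?G" by (intro continuous_intros)
      show "?G z \<in> flow_set H" if "z \<in> jump_set H" for z
        using T by (simp add: H HAND2_def)
      show "closed (jump_set H)"
        unfolding D by (intro closed_Times closed_UNIV closed_singleton)
      show "jump_set H \<subseteq> flow_set H" using T by (auto simp: H HAND2_def)
      show "HAND_energy f c xs (?G z) \<le> HAND_energy f c xs z" if zD: "z \<in> jump_set H" for z
      proof -
        obtain x1 x2 where z: "z = (x1, x2, Tmax)" using zD by (cases z) (simp add: D)
        show ?thesis
          using energy[of x1 x2] \<delta>[of x1 x2] unfolding z fst_conv by linarith
      qed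
      show "HAND_auxiliary (1 / Tmax) xs (?G (x1, x2, \<tau>)) < HAND_auxiliary (1 / Tmax) xs (x1, x2, \<tau>)"
        if D_mem: "(x1, x2, \<tau>) \<in> jump_set H" and off: "x1 \<noteq> xs \<or> x2 \<noteq> xs"
          and same: "HAND_energy f c xs (?G (x1, x2, \<tau>)) = HAND_energy f c xs (x1, x2, \<tau>)" for x1 x2 \<tau>
      proof -
        have "\<tau> = Tmax" using D_mem by (simp add: D)
        with same have "HAND_energy f c xs (x1, x1, Tmin) = HAND_energy f c xs (x1, x2, Tmax)"
          by simp
        with energy[of x1 x2] \<delta>_pos[OF off] show ?thesis by linarith
      qed
    qed
  qed
qed

end
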